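(* For every integer $n\geq 3$, the group $$M_{3^n}=\langle a,b \mid a^{3^{n-1}}=b^3=e,\ b^{-1}ab=a^{3^{n-2}+1}\rangle$$ is not a Schur group; that is, there exists an $S$-ring over $M_{3^n}$ which is not schurian.
   Context: Let $G$ be a finite group with identity $e$, and for $X\subseteq G$ write $\underline{X}=\sum_{x\in X}x\in\mathbb{Z}G$. A subring $\mathcal{A}$ of the integral group ring $\mathbb{Z}G$ is an $S$-ring over $G$ if there is a partition $\mathcal{S}(\mathcal{A})$ of $G$ (its basic sets) such that $\{e\}\in\mathcal{S}(\mathcal{A})$, $X\in\mathcal{S}(\mathcal{A})\Rightarrow X^{-1}\in\mathcal{S}(\mathcal{A})$, and $\mathcal{A}=\mathrm{Span}_{\mathbb{Z}}\{\underline{X}: X\in\mathcal{S}(\mathcal{A})\}$. Let $G_{right}=\{x\mapsto xg : g\in G\}\leq \mathrm{Sym}(G)$. For a permutation group $\Gamma$ with $G_{right}\leq\Gamma\leq\mathrm{Sym}(G)$, the module spanned by $\underline{X}$ for $X$ ranging over the orbits of the stabilizer $\Gamma_e$ on $G$ is an $S$-ring, denoted $\mathcal{A}(\Gamma,G)$. An $S$-ring $\mathcal{A}$ over $G$ is schurian if $\mathcal{A}=\mathcal{A}(\Gamma,G)$ for some such $\Gamma$. A finite group $G$ is a Schur group if every $S$-ring over $G$ is schurian. *)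

theory Defs
  imports "HOL-Algebra.Bij" "HOL-Algebra.Generated_Groups"
begin

text \<open>Elements of the integral group ring ZG of a finite group G are represented as
  integer-valued functions on the carrier (vanishing outside it).\<close>

definition grp_ring_elts :: "('a, 'b) monoid_scheme \<Rightarrow> ('a \<Rightarrow> int) set" where
  "grp_ring_elts G = {f. \<forall>x. x \<notin> carrier G \<longrightarrow> f x = 0}"

definition gr_mult :: "('a, 'b) monoid_scheme \<Rightarrow> ('a \<Rightarrow> int) \<Rightarrow> ('a \<Rightarrow> int) \<Rightarrow> ('a \<Rightarrow> int)" where
  "gr_mult G f g = (\<lambda>x. if x \<in> carrier G
      then (\<Sum>y\<in>carrier G. f y * g (inv\<^bsub>G\<^esub> y \<otimes>\<^bsub>G\<^esub> x)) else 0)"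

text \<open>The element underline X = sum of the elements of X.\<close>
definition ul :: "'a set \<Rightarrow> ('a \<Rightarrow> int)" where
  "ul X = (\<lambda>x. if x \<in> X then 1 else 0)"

definition gr_one :: "('a, 'b) monoid_scheme \<Rightarrow> ('a \<Rightarrow> int)" where
  "gr_one G = ul {\<one>\<^bsub>G\<^esub>}"

definition zspan :: "'a set set \<Rightarrow> ('a \<Rightarrow> int) set" where
  "zspan S = {f. \<exists>c :: 'a set \<Rightarrow> int. f = (\<lambda>x. \<Sum>X\<in>S. c X * ul X x)}"

definition is_gr_subring :: "('a, 'b) monoid_scheme \<Rightarrow> ('a \<Rightarrow> int) set \<Rightarrow> bool" where
  "is_gr_subring G A \<longleftrightarrow> A \<subseteq> grp_ring_elts G \<and> gr_one G \<in> A \<and> (\<lambda>x. 0) \<in> A \<and>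
     (\<forall>f\<in>A. \<forall>g\<in>A. (\<lambda>x. f x + g x) \<in> A) \<and> (\<forall>f\<in>A. (\<lambda>x. - f x) \<in> A) \<and>
     (\<forall>f\<in>A. \<forall>g\<in>A. gr_mult G f g \<in> A)"

definition is_partition_of :: "'a set set \<Rightarrow> 'a set \<Rightarrow> bool" where
  "is_partition_of S U \<longleftrightarrow> (\<forall>X\<in>S. X \<noteq> {} \<and> X \<subseteq> U) \<and> \<Union>S = U \<and>
     (\<forall>X\<in>S. \<forall>Y\<in>S. X \<noteq> Y \<longrightarrow> X \<inter> Y = {})"

definition is_S_ring :: "('a, 'b) monoid_scheme \<Rightarrow> ('a \<Rightarrow> int) set \<Rightarrow> bool" where
  "is_S_ring G A \<longleftrightarrow> is_gr_subring G A \<and>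
     (\<exists>S. is_partition_of S (carrier G) \<and> {\<one>\<^bsub>G\<^esub>} \<in> S \<and>
          (\<forall>X\<in>S. (\<lambda>x. inv\<^bsub>G\<^esub> x) ` X \<in> S) \<and> A = zspan S)"

text \<open>G_right, as permutations of carrier G (extensional, as in BijGroup).\<close>
definition right_regular :: "('a, 'b) monoid_scheme \<Rightarrow> ('a \<Rightarrow> 'a) set" where
  "right_regular G = {(\<lambda>x\<in>carrier G. x \<otimes>\<^bsub>G\<^esub> g) | g. g \<in> carrier G}"

definition stab_orbits :: "('a, 'b) monoid_scheme \<Rightarrow> ('a \<Rightarrow> 'a) set \<Rightarrow> 'a set set" where
  "stab_orbits G \<Gamma> = {{\<gamma> x | \<gamma>. \<gamma> \<in> \<Gamma> \<and> \<gamma> \<one>\<^bsub>G\<^esub> = \<one>\<^bsub>G\<^esub>} | x. x \<in> carrier G}"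

definition schurian :: "('a, 'b) monoid_scheme \<Rightarrow> ('a \<Rightarrow> int) set \<Rightarrow> bool" where
  "schurian G A \<longleftrightarrow> (\<exists>\<Gamma>. subgroup \<Gamma> (BijGroup (carrier G)) \<and> right_regular G \<subseteq> \<Gamma> \<and>
      A = zspan (stab_orbits G \<Gamma>))"

definition Schur_group :: "('a, 'b) monoid_scheme \<Rightarrow> bool" where
  "Schur_group G \<longleftrightarrow> (\<forall>A. is_S_ring G A \<longrightarrow> schurian G A)"

end

theory Submission
  imports Defs "HOL-Combinatorics.Cycles"
begin

text \<open>
  Put \<open>m = 3\<^sup>n\<^sup>-\<^sup>2\<close> and let \<open>c = a\<^sup>m\<close> generate the commutator subgroup \<open>C\<close>, \<open>B = \<langle>b\<rangle>\<close> and \<open>H = C B\<close>.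

  For \<open>n \<ge> 4\<close> take the S-ring whose basic sets are the pairs \<open>{h, h\<inverse>}\<close> in \<open>H\<close>, the sets
  \<open>z C\<close> and \<open>z (H - C)\<close> for \<open>z \<notin> H\<close> in \<open>\<langle>a\<^sup>3\<rangle>\<close>, the sets
  \<open>a B\<close>, \<open>a (H - B)\<close> and their inverses, and all other cosets of \<open>H\<close>. If it were schurian, some
  colour preserving permutation \<open>\<delta>\<close> fixing \<open>e\<close> would invert \<open>c\<close>, and one may assume that its order is
  a power of 2. Then \<open>\<delta>\<close> has a fixed point in every three-element set \<open>a B x\<close> or \<open>z C x\<close> with \<open>x\<close>
  fixed, but only one fixed point in the coset \<open>H x\<close>: two would force \<open>\<delta>\<close> to be the identity on \<open>H x\<close>,
  then on \<open>a H x\<close>, and finally on \<open>H\<close>. Following the fixed points around the cycle of cosets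
  \<open>a\<^sup>i H\<close> leads from \<open>e\<close> to \<open>a\<^sup>m = c\<close>, a contradiction.

  For \<open>n = 3\<close> this cycle is too short, and an S-ring of rank 4 coming from a spread of the
  generalized quadrangle of order (2, 4) is used instead.
\<close>

section \<open>Coordinates in the group\<close>

text \<open>Here \<open>m\<close> stands for \<open>3 ^ (n - 2)\<close>, taken as an integer so that
  exponents can be handled by congruences. \<open>card_carrier\<close> is what makes the normal form
  \<open>E k y\<close> unique.\<close>

locale modular_3_group = group G for G (structure) +
  fixes a b :: 'a and m :: int
  assumes m_pos: "0 < m" and three_dvd_m: "3 dvd m"
    and a_closed: "a \<in> carrier G" and b_closed: "b \<in> carrier G"
    and generated: "generate G {a, b} = carrier G"
    and a_order: "a [^] (3 * m) = \<one>" and b_order: "b [^] (3 :: int) = \<one>"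
    and conj: "inv b \<otimes> a \<otimes> b = a [^] (m + 1)"
    and card_carrier: "card (carrier G) = nat (9 * m)"
begin

lemmas gens [simp] = a_closed b_closed

definition E :: "int \<Rightarrow> int \<Rightarrow> 'a" where
  "E k y = a [^] k \<otimes> b [^] y"

lemma E_closed [simp]: "E k y \<in> carrier G"
  by (simp add: E_def)

lemma a_pow_cong: "3 * m dvd k - l \<Longrightarrow> a [^] k = a [^] l"
proof -
  assume "3 * m dvd k - l"
  then obtain t where "k - l = 3 * m * t" ..
  then have k: "k = 3 * m * t + l" by simp
  show ?thesis
    by (simp add: k int_pow_mult int_pow_pow [symmetric] a_order)
qed

lemma b_pow_cong: "3 dvd k - l \<Longrightarrow> b [^] (k :: int) = b [^] l"
proof -
  assume "3 dvd k - l"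
  then obtain t where "k - l = 3 * t" ..
  then have k: "k = 3 * t + l" by simp
  show ?thesis
    by (simp add: k int_pow_mult int_pow_pow [symmetric] b_order)
qed

lemma E_cong: "3 * m dvd k - l \<Longrightarrow> 3 dvd y - z \<Longrightarrow> E k y = E l z"
  by (simp add: E_def a_pow_cong [of k l] b_pow_cong [of y z])

text \<open>Multiples of \<open>m * m\<close> may be dropped from exponents of \<open>a\<close>; the
  exponent calculations below rest on this.\<close>

lemma dvd_msq: "3 * m dvd m * m * t"
  using three_dvd_m by (auto simp: dvd_def algebra_simps)

text \<open>The map taking \<open>x\<close> to \<open>inv b \<otimes> x \<otimes> b\<close> raises
  powers of \<open>a\<close> to the power \<open>m + 1\<close>. Its inverse raises them to
  \<open>1 - m\<close>, because the product of the two exponents is 1 modulo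
  \<open>3 * m\<close>.\<close>

lemma b_a_pow: "b \<otimes> a [^] l = a [^] (l * (1 - m)) \<otimes> b"
proof -
  have "(\<lambda>x. inv b \<otimes> x \<otimes> b) \<in> hom G G"
  proof (rule homI)
    fix x y assume "x \<in> carrier G" "y \<in> carrier G"
    then have "inv b \<otimes> x \<otimes> b \<otimes> (inv b \<otimes> y \<otimes> b) = inv b \<otimes> x \<otimes> (b \<otimes> inv b) \<otimes> y \<otimes> b"
      by (simp only: m_assoc m_closed inv_closed gens)
    with \<open>x \<in> _\<close> \<open>y \<in> _\<close> show "inv b \<otimes> (x \<otimes> y) \<otimes> b = inv b \<otimes> x \<otimes> b \<otimes> (inv b \<otimes> y \<otimes> b)"
      by (simp add: m_assoc)
  qed simp
  then interpret h: group_hom G G "\<lambda>x. inv b \<otimes> x \<otimes> b"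
    by unfold_locales
  have *: "inv b \<otimes> a [^] k \<otimes> b = a [^] (k * (m + 1))" for k :: int
    using h.hom_int_pow [of a k] by (simp add: conj int_pow_pow mult.commute)
  have "inv b \<otimes> a [^] (l * (1 - m)) \<otimes> b = a [^] (l * (1 - m) * (m + 1))"
    by (rule *)
  also have "\<dots> = a [^] l"
    using dvd_msq [of "-l"] by (intro a_pow_cong) (simp add: algebra_simps)
  finally have "b \<otimes> (inv b \<otimes> a [^] (l * (1 - m)) \<otimes> b) = b \<otimes> a [^] l" by simp
  then show ?thesis by (simp add: m_assoc [symmetric])
qed

text \<open>Modulo \<open>3 * m\<close> the powers of \<open>1 - m\<close> are linear in the
  exponent. Reducing \<open>y\<close> modulo 3 leaves natural exponents, where induction
  applies.\<close>

lemma b_pow_a_pow: "b [^] (y :: int) \<otimes> a [^] l = a [^] (l - m * l * y) \<otimes> b [^] y"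
proof -
  have nat: "b [^] i \<otimes> a [^] l = a [^] (l - m * l * int i) \<otimes> b [^] i" for i :: nat
  proof (induction i)
    case (Suc i)
    have "b [^] Suc i \<otimes> a [^] l = b \<otimes> (b [^] i \<otimes> a [^] l)"
      by (simp only: nat_pow_Suc2 m_assoc gens nat_pow_closed int_pow_closed)
    also have "\<dots> = (b \<otimes> a [^] (l - m * l * int i)) \<otimes> b [^] i"
      by (simp add: Suc m_assoc)
    also have "\<dots> = a [^] ((l - m * l * int i) * (1 - m)) \<otimes> (b \<otimes> b [^] i)"
      by (simp add: b_a_pow m_assoc)
    also have "a [^] ((l - m * l * int i) * (1 - m)) = a [^] (l - m * l * int (Suc i))"
      using dvd_msq [of "l * int i"] by (intro a_pow_cong) (simp add: algebra_simps)
    finally show ?case by (simp only: nat_pow_Suc2 gens)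
  qed simp
  have "b [^] y \<otimes> a [^] l = b [^] nat (y mod 3) \<otimes> a [^] l"
    using b_pow_cong [of y "y mod 3"] by (simp add: int_pow_int [symmetric] dvd_minus_mod)
  also have "\<dots> = a [^] (l - m * l * (y mod 3)) \<otimes> b [^] nat (y mod 3)"
    using nat [of "nat (y mod 3)"] by simp
  also have "b [^] nat (y mod 3) = b [^] y"
    using b_pow_cong [of y "y mod 3"] by (simp add: int_pow_int [symmetric] dvd_minus_mod)
  also have "a [^] (l - m * l * (y mod 3)) = a [^] (l - m * l * y)"
  proof (rule a_pow_cong)
    have "3 * m dvd (y - y mod 3) * m" by (intro mult_dvd_mono) (auto simp: dvd_minus_mod)
    then have "3 * m dvd (y - y mod 3) * m * l" by (rule dvd_mult2)
    then show "3 * m dvd (l - m * l * (y mod 3)) - (l - m * l * y)" by (simp add: algebra_simps)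
  qed
  finally show ?thesis .
qed

lemma E_mult: "E k y \<otimes> E l z = E (k + l - m * l * y) (y + z)"
proof -
  have "E k y \<otimes> E l z = a [^] k \<otimes> (b [^] y \<otimes> a [^] l) \<otimes> b [^] z"
    by (simp add: E_def m_assoc)
  also have "\<dots> = (a [^] k \<otimes> a [^] (l - m * l * y)) \<otimes> (b [^] y \<otimes> b [^] z)"
    by (simp add: b_pow_a_pow m_assoc)
  also have "\<dots> = a [^] (k + (l - m * l * y)) \<otimes> b [^] (y + z)"
    by (simp only: int_pow_mult gens)
  finally show ?thesis by (simp only: E_def add_diff_eq)
qed

lemma E_0_0: "E 0 0 = \<one>" by (simp add: E_def)

lemma E_inv: "inv (E l z) = E (- l - m * l * z) (- z)"
proof (rule inv_equality)
  have "E (- l - m * l * z) (- z) \<otimes> E l z = E 0 0"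
    using dvd_msq by (simp add: E_mult)
  then show "E (- l - m * l * z) (- z) \<otimes> E l z = \<one>" by (simp add: E_0_0)
qed auto

lemma E_exhaust: "x \<in> carrier G \<Longrightarrow> \<exists>k y. x = E k y"
proof -
  assume "x \<in> carrier G"
  then have "x \<in> generate G {a, b}" by (simp add: generated)
  then show ?thesis
  proof (induction rule: generate.induct)
    case one
    then show ?case using E_0_0 by metis
  next
    case (incl h)
    have "a = E 1 0" "b = E 0 1" by (simp_all add: E_def int_pow_1)
    with incl show ?case by auto
  next
    case (inv h)
    have "a = E 1 0" "b = E 0 1" by (simp_all add: E_def int_pow_1)
    with inv E_inv show ?case by (metis insertE singletonD)
  next
    case (eng h1 h2)
    then show ?case using E_mult by metis
  qed
qed

text \<open>Surjectivity comes from \<open>E_exhaust\<close>; injectivity follows by counting, as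
  both sides have \<open>9 * m\<close> elements.\<close>

lemma E_bij: "bij_betw (\<lambda>(k, y). E k y) ({0..<3 * m} \<times> {0..<3}) (carrier G)"
proof -
  let ?D = "{0..<3 * m} \<times> {0..<3 :: int}"
  have im: "(\<lambda>(k, y). E k y) ` ?D = carrier G"
  proof (intro equalityI subsetI)
    fix x assume "x \<in> carrier G"
    then obtain k y where x: "x = E k y" using E_exhaust by blast
    have "x = E (k mod (3 * m)) (y mod 3)"
      unfolding x by (rule E_cong) (simp_all add: dvd_minus_mod)
    moreover have "(k mod (3 * m), y mod 3) \<in> ?D" using m_pos by simp
    ultimately show "x \<in> (\<lambda>(k, y). E k y) ` ?D" by force
  qed auto
  have "card ?D = card (carrier G)"
    using m_pos by (simp add: card_cartesian_product card_carrier nat_mult_distrib)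
  then have "inj_on (\<lambda>(k, y). E k y) ?D"
    using im by (intro eq_card_imp_inj_on) auto
  with im show ?thesis by (simp add: bij_betw_def)
qed

lemma finite_carrier: "finite (carrier G)"
  using card_carrier m_pos by (intro card_ge_0_finite) simp

lemma E_eq_iff: "E k y = E l z \<longleftrightarrow> 3 * m dvd k - l \<and> 3 dvd y - z"
proof
  assume eq: "E k y = E l z"
  have "E (k mod (3 * m)) (y mod 3) = E k y" "E (l mod (3 * m)) (z mod 3) = E l z"
    by (rule E_cong; simp add: mod_eq_dvd_iff [symmetric])+
  with eq have "E (k mod (3 * m)) (y mod 3) = E (l mod (3 * m)) (z mod 3)" by simp
  then have "(k mod (3 * m), y mod 3) = (l mod (3 * m), z mod 3)"
    using m_pos by (intro inj_onD [OF bij_betw_imp_inj_on [OF E_bij]]) auto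
  then show "3 * m dvd k - l \<and> 3 dvd y - z" by (simp add: mod_eq_dvd_iff)
qed (use E_cong in blast)

text \<open>Such quotients are unchanged by right translations, so they serve as the colours of
  pairs of points.\<close>

lemma E_div: "E k y \<otimes> inv (E l z) = E (k - l + m * l * (y - z)) (y - z)"
proof -
  have "E k y \<otimes> inv (E l z)
      = E (k + (- l - m * l * z) - m * (- l - m * l * z) * y) (y + - z)"
    by (simp add: E_inv E_mult)
  also have "\<dots> = E (k - l + m * l * (y - z)) (y - z)"
    using dvd_msq [of "l * z * y"] by (intro E_cong) (simp_all add: algebra_simps)
  finally show ?thesis .
qed

lemma gr_mult_E:
  "gr_mult G f g (E k y) = (\<Sum>l\<in>{0..<3 * m}. \<Sum>z\<in>{0..<3}.
     f (E l z) * g (E (k - l + m * z * (k - l)) (y - z)))"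
proof -
  have ld: "inv (E l z) \<otimes> E k y = E (k - l + m * z * (k - l)) (y - z)" for l z
  proof -
    have "- l - m * l * z + k - m * k * (- z) = k - l + m * z * (k - l)"
      by (simp add: algebra_simps)
    moreover have "- z + y = y - z" by simp
    ultimately show ?thesis by (simp only: E_inv E_mult)
  qed
  have "gr_mult G f g (E k y) = (\<Sum>x\<in>carrier G. f x * g (inv x \<otimes> E k y))"
    by (simp add: gr_mult_def)
  also have "\<dots> = (\<Sum>(l, z)\<in>{0..<3 * m} \<times> {0..<3}. f (E l z) * g (inv (E l z) \<otimes> E k y))"
    by (subst sum.reindex_bij_betw [OF E_bij, symmetric]) (simp add: case_prod_unfold)
  finally show ?thesis by (simp add: sum.cartesian_product ld)
qed

end

section \<open>S-rings given by linear conditions, and colour preserving permutations\<close>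

text \<open>The coefficient of a block is the value of \<open>f\<close> at any of its
  points.\<close>

lemma mem_zspan_partition:
  assumes "is_partition_of S C" "finite C"
  shows "f \<in> zspan S \<longleftrightarrow> (\<forall>x. x \<notin> C \<longrightarrow> f x = 0) \<and> (\<forall>X\<in>S. \<forall>x\<in>X. \<forall>y\<in>X. f x = f y)"
proof -
  from assms(1) have U: "\<Union>S = C" and ne: "\<And>X. X \<in> S \<Longrightarrow> X \<noteq> {}"
    and disj: "\<And>X Y. X \<in> S \<Longrightarrow> Y \<in> S \<Longrightarrow> X \<noteq> Y \<Longrightarrow> X \<inter> Y = {}"
    by (auto simp: is_partition_of_def)
  have fin: "finite S" using U \<open>finite C\<close> by (metis finite_UnionD)
  have at: "(\<Sum>Y\<in>S. c Y * ul Y x) = c X" if "X \<in> S" "x \<in> X" for c :: "'a set \<Rightarrow> int" and X x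
  proof -
    have "(\<Sum>Y\<in>S. c Y * ul Y x) = (\<Sum>Y\<in>S. if Y = X then c X else 0)"
      using that disj by (intro sum.cong) (auto simp: ul_def)
    then show ?thesis using fin that by simp
  qed
  have off: "(\<Sum>Y\<in>S. c Y * ul Y x) = 0" if "x \<notin> C" for c :: "'a set \<Rightarrow> int" and x
    using that U by (intro sum.neutral) (auto simp: ul_def)
  show ?thesis
  proof
    assume "f \<in> zspan S"
    then obtain c where "f = (\<lambda>x. \<Sum>X\<in>S. c X * ul X x)" by (auto simp: zspan_def)
    then show "(\<forall>x. x \<notin> C \<longrightarrow> f x = 0) \<and> (\<forall>X\<in>S. \<forall>x\<in>X. \<forall>y\<in>X. f x = f y)"
      by (auto simp: at off)
  next
    assume R: "(\<forall>x. x \<notin> C \<longrightarrow> f x = 0) \<and> (\<forall>X\<in>S. \<forall>x\<in>X. \<forall>y\<in>X. f x = f y)"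
    have "f = (\<lambda>x. \<Sum>X\<in>S. f (SOME y. y \<in> X) * ul X x)"
    proof
      fix x
      show "f x = (\<Sum>X\<in>S. f (SOME y. y \<in> X) * ul X x)"
      proof (cases "x \<in> C")
        case True
        then obtain X where X: "X \<in> S" "x \<in> X" using U by blast
        then have "f (SOME y. y \<in> X) = f x" using R by (metis someI)
        with at [OF X, of "\<lambda>X. f (SOME y. y \<in> X)"] show ?thesis by simp
      next
        case False
        with R off show ?thesis by simp
      qed
    qed
    then show "f \<in> zspan S" unfolding zspan_def
      by (intro CollectI exI [of _ "\<lambda>X. f (SOME y. y \<in> X)"])
  qed
qed

text \<open>The basic sets are given only implicitly, as the classes generated by the pairs in
  \<open>Mv\<close>. Closure under products then becomes one equation for each pair.\<close>

definition move_ring :: "('a, 'b) monoid_scheme \<Rightarrow> ('a \<times> 'a) set \<Rightarrow> ('a \<Rightarrow> int) set" where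
  "move_ring G Mv = {f \<in> grp_ring_elts G. \<forall>(x, y)\<in>Mv. f x = f y}"

lemma ul_mem_move_ring:
  assumes "X \<subseteq> carrier G" "\<And>x y. (x, y) \<in> Mv \<Longrightarrow> x \<in> X \<longleftrightarrow> y \<in> X"
  shows "ul X \<in> move_ring G Mv"
  using assms unfolding move_ring_def grp_ring_elts_def ul_def by force

text \<open>The basic sets are recovered as the classes of \<open>r\<close>, which relates two
  elements when no function in the ring separates them.\<close>

lemma (in group) is_S_ring_move_ring:
  assumes fin: "finite (carrier G)" and Mv: "Mv \<subseteq> carrier G \<times> carrier G"
    and one: "\<And>x y. (x, y) \<in> Mv \<Longrightarrow> x = \<one> \<longleftrightarrow> y = \<one>"
    and inv: "\<And>f x y. f \<in> move_ring G Mv \<Longrightarrow> (x, y) \<in> Mv \<Longrightarrow> f (inv x) = f (inv y)"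
    and mult: "\<And>f g x y. f \<in> move_ring G Mv \<Longrightarrow> g \<in> move_ring G Mv \<Longrightarrow> (x, y) \<in> Mv \<Longrightarrow>
      gr_mult G f g x = gr_mult G f g y"
  shows "is_S_ring G (move_ring G Mv)"
proof -
  let ?A = "move_ring G Mv"
  define r where "r = {(x, y). x \<in> carrier G \<and> y \<in> carrier G \<and> (\<forall>f\<in>?A. f x = f y)}"
  have eq: "equiv (carrier G) r"
    by (rule equivI) (auto simp: r_def refl_on_def sym_def trans_def)
  have part: "is_partition_of (carrier G // r) (carrier G)"
    unfolding is_partition_of_def
    using Union_quotient [OF eq] in_quotient_imp_non_empty [OF eq] in_quotient_imp_subset [OF eq]
      quotient_disj [OF eq] by blast
  have span: "?A = zspan (carrier G // r)"
  proof (rule Set.set_eqI)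
    fix f :: "'a \<Rightarrow> int"
    have cls: "(\<forall>X\<in>carrier G // r. \<forall>x\<in>X. \<forall>y\<in>X. f x = f y) \<longleftrightarrow> (\<forall>(x, y)\<in>r. f x = f y)"
    proof
      assume L: "\<forall>X\<in>carrier G // r. \<forall>x\<in>X. \<forall>y\<in>X. f x = f y"
      show "\<forall>(x, y)\<in>r. f x = f y"
      proof clarify
        fix x y assume xy: "(x, y) \<in> r"
        then have "x \<in> carrier G" by (simp add: r_def)
        then have "r `` {x} \<in> carrier G // r" "x \<in> r `` {x}" "y \<in> r `` {x}"
          using xy equiv_class_self [OF eq] quotientI by auto
        with L show "f x = f y" by blast
      qed
    next
      assume R: "\<forall>(x, y)\<in>r. f x = f y"
      show "\<forall>X\<in>carrier G // r. \<forall>x\<in>X. \<forall>y\<in>X. f x = f y"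
        using R in_quotient_imp_in_rel [OF eq] by blast
    qed
    have "f \<in> ?A \<longleftrightarrow> (\<forall>x. x \<notin> carrier G \<longrightarrow> f x = 0) \<and> (\<forall>(x, y)\<in>r. f x = f y)"
    proof
      assume "f \<in> ?A"
      then show "(\<forall>x. x \<notin> carrier G \<longrightarrow> f x = 0) \<and> (\<forall>(x, y)\<in>r. f x = f y)"
        unfolding r_def by (simp add: move_ring_def grp_ring_elts_def)
    next
      assume R: "(\<forall>x. x \<notin> carrier G \<longrightarrow> f x = 0) \<and> (\<forall>(x, y)\<in>r. f x = f y)"
      have "Mv \<subseteq> r" using Mv by (auto simp: r_def move_ring_def)
      with R show "f \<in> ?A" by (auto simp: move_ring_def grp_ring_elts_def)
    qed
    then show "f \<in> ?A \<longleftrightarrow> f \<in> zspan (carrier G // r)"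
      by (simp add: mem_zspan_partition [OF part fin] cls)
  qed
  have ul1: "ul {\<one>} \<in> ?A"
    by (rule ul_mem_move_ring) (use one in auto)
  have invA: "(\<lambda>x. if x \<in> carrier G then f (inv x) else 0) \<in> ?A" if "f \<in> ?A" for f
    using inv [OF that] Mv by (auto simp: move_ring_def grp_ring_elts_def)
  have rD: "f x = f y" if "f \<in> ?A" "(x, y) \<in> r" for f x y
    using that by (auto simp: r_def)
  have inv_r: "(inv x, inv y) \<in> r" if "(x, y) \<in> r" for x y
  proof -
    have "f (inv x) = f (inv y)" if "f \<in> ?A" for f
    proof -
      have "(if x \<in> carrier G then f (inv x) else 0) = (if y \<in> carrier G then f (inv y) else 0)"
        by (rule rD [OF invA [OF that] \<open>(x, y) \<in> r\<close>])
      then show ?thesis using \<open>(x, y) \<in> r\<close> by (simp add: r_def)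
    qed
    with that show ?thesis by (simp add: r_def)
  qed
  have one_cls: "{\<one>} \<in> carrier G // r"
  proof -
    have "r `` {\<one>} = {\<one>}"
    proof -
      have "y = \<one>" if "(\<one>, y) \<in> r" for y
      proof -
        have "ul {\<one>} \<one> = ul {\<one>} y" by (rule rD [OF ul1 that])
        then show ?thesis by (simp add: ul_def split: if_splits)
      qed
      then show ?thesis by (auto simp: r_def)
    qed
    then show ?thesis by (metis one_closed quotientI)
  qed
  have inv_cls: "(\<lambda>x. inv x) ` X \<in> carrier G // r" if X: "X \<in> carrier G // r" for X
  proof -
    obtain x where x: "x \<in> carrier G" "X = r `` {x}" by (rule quotientE [OF X])
    have "(\<lambda>x. inv x) ` (r `` {x}) = r `` {inv x}"
    proof (intro equalityI subsetI)
      fix y assume "y \<in> r `` {inv x}"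
      then have xy: "(inv x, y) \<in> r" by simp
      then have "y \<in> carrier G" by (simp add: r_def)
      with inv_r [OF xy] x have "inv y \<in> r `` {x}" "y = inv (inv y)" by simp_all
      then show "y \<in> (\<lambda>x. inv x) ` (r `` {x})" by (metis imageI)
    qed (use inv_r in auto)
    then show ?thesis using x by (simp add: quotientI)
  qed
  have "is_gr_subring G ?A"
    unfolding is_gr_subring_def gr_one_def
  proof (intro conjI ballI)
    show "ul {\<one>} \<in> ?A" by (rule ul1)
    fix f g assume "f \<in> ?A" "g \<in> ?A"
    then show "gr_mult G f g \<in> ?A"
      using mult unfolding move_ring_def grp_ring_elts_def by (auto simp: gr_mult_def)
  qed (auto simp: move_ring_def grp_ring_elts_def case_prod_unfold)
  with part one_cls inv_cls span show ?thesis unfolding is_S_ring_def by blast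
qed

text \<open>For an S-ring \<open>A\<close> the sets \<open>X\<close> with
  \<open>ul X \<in> A\<close> are the unions of basic sets, so the basic sets need not be
  named.\<close>

definition col_preserving :: "('a, 'b) monoid_scheme \<Rightarrow> ('a \<Rightarrow> int) set \<Rightarrow> ('a \<Rightarrow> 'a) \<Rightarrow> bool" where
  "col_preserving G A \<gamma> \<longleftrightarrow> bij_betw \<gamma> (carrier G) (carrier G) \<and> \<gamma> \<one>\<^bsub>G\<^esub> = \<one>\<^bsub>G\<^esub> \<and>
     (\<forall>X. ul X \<in> A \<longrightarrow> (\<forall>x\<in>carrier G. \<forall>y\<in>carrier G.
        \<gamma> y \<otimes>\<^bsub>G\<^esub> inv\<^bsub>G\<^esub> (\<gamma> x) \<in> X \<longleftrightarrow> y \<otimes>\<^bsub>G\<^esub> inv\<^bsub>G\<^esub> x \<in> X))"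

lemma col_preservingD:
  assumes "col_preserving G A \<gamma>" "ul X \<in> A" "x \<in> carrier G" "y \<in> carrier G"
  shows "\<gamma> y \<otimes>\<^bsub>G\<^esub> inv\<^bsub>G\<^esub> (\<gamma> x) \<in> X \<longleftrightarrow> y \<otimes>\<^bsub>G\<^esub> inv\<^bsub>G\<^esub> x \<in> X"
  using assms by (simp add: col_preserving_def)

lemma col_preserving_closed:
  "col_preserving G A \<gamma> \<Longrightarrow> x \<in> carrier G \<Longrightarrow> \<gamma> x \<in> carrier G"
  using bij_betwE by (auto simp: col_preserving_def)

lemma col_preserving_funpow:
  "col_preserving G A \<gamma> \<Longrightarrow> col_preserving G A (\<gamma> ^^ i)"
proof (induction i)
  case (Suc i)
  let ?d = "\<gamma> ^^ i"
  have b: "bij_betw ?d (carrier G) (carrier G)" "bij_betw \<gamma> (carrier G) (carrier G)"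
    using Suc by (auto simp: col_preserving_def)
  then have "?d x \<in> carrier G" if "x \<in> carrier G" for x
    using that bij_betwE by blast
  moreover have "bij_betw (\<gamma> \<circ> ?d) (carrier G) (carrier G)"
    using b by (rule bij_betw_trans)
  ultimately show ?case
    using Suc by (simp add: col_preserving_def comp_def)
qed (simp add: col_preserving_def)

text \<open>The orbit of \<open>x\<close> under the stabilizer of the identity has its indicator in
  \<open>A\<close>, so \<open>y\<close> lies in it and some element of the stabilizer moves
  \<open>x\<close> to \<open>y\<close>.\<close>

lemma (in group) schurian_col_preserving:
  assumes fin: "finite (carrier G)" and A: "schurian G A"
    and x: "x \<in> carrier G" and y: "y \<in> carrier G" and xy: "\<And>f. f \<in> A \<Longrightarrow> f x = f y"
  obtains \<gamma> where "col_preserving G A \<gamma>" "\<gamma> x = y"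
proof -
  let ?C = "carrier G"
  from A obtain \<Gamma> where \<Gamma>: "subgroup \<Gamma> (BijGroup ?C)" and right: "right_regular G \<subseteq> \<Gamma>"
    and span: "A = zspan (stab_orbits G \<Gamma>)" by (auto simp: schurian_def)
  interpret B: group "BijGroup ?C" by (rule group_BijGroup)
  have sub: "\<Gamma> \<subseteq> Bij ?C" using subgroup.subset [OF \<Gamma>] by (simp add: BijGroup_def)
  have comp: "compose ?C g f \<in> \<Gamma>" if "g \<in> \<Gamma>" "f \<in> \<Gamma>" for f g
    using subgroup.m_closed [OF \<Gamma> that] that sub by (auto simp: BijGroup_def restrict_def subset_iff)
  have bij: "bij_betw g ?C ?C" if "g \<in> \<Gamma>" for g
    using that sub by (auto simp: Bij_def)
  have closed: "g z \<in> ?C" if "g \<in> \<Gamma>" "z \<in> ?C" for g z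
    using bij [OF that(1)] that(2) bij_betwE by blast
  have idG: "(\<lambda>z\<in>?C. z) \<in> \<Gamma>"
    using subgroup.one_closed [OF \<Gamma>] by (simp add: BijGroup_def)
  have inv: "restrict (inv_into ?C g) ?C \<in> \<Gamma>" if "g \<in> \<Gamma>" for g
    using subgroup.m_inv_closed [OF \<Gamma> that] that sub by (auto simp: inv_BijGroup subset_iff restrict_def)
  define orb where "orb z = {g z | g. g \<in> \<Gamma> \<and> g \<one> = \<one>}" for z
  have S: "stab_orbits G \<Gamma> = orb ` ?C" by (auto simp: stab_orbits_def orb_def)
  have self: "z \<in> orb z" if "z \<in> ?C" for z
    unfolding orb_def using idG that by (intro CollectI exI [of _ "\<lambda>z\<in>?C. z"]) auto
  have orb_C: "orb z \<subseteq> ?C" if "z \<in> ?C" for z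
    using that closed by (auto simp: orb_def)
  have step: "orb w \<subseteq> orb z" if z: "z \<in> ?C" and w: "w \<in> orb z" for z w
  proof
    fix v assume "v \<in> orb w"
    then obtain g where g: "g \<in> \<Gamma>" "g \<one> = \<one>" "v = g w" by (auto simp: orb_def)
    obtain h where h: "h \<in> \<Gamma>" "h \<one> = \<one>" "w = h z" using w by (auto simp: orb_def)
    have "compose ?C g h \<in> \<Gamma>" "compose ?C g h \<one> = \<one>" "v = compose ?C g h z"
      using g h z comp by (auto simp: compose_def)
    then show "v \<in> orb z" by (auto simp: orb_def)
  qed
  have sym: "z \<in> orb w" if z: "z \<in> ?C" and w: "w \<in> orb z" for z w
  proof -
    obtain h where h: "h \<in> \<Gamma>" "h \<one> = \<one>" "w = h z" using w by (auto simp: orb_def)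
    have inj: "inj_on h ?C" using bij [OF h(1)] by (simp add: bij_betw_def)
    let ?i = "restrict (inv_into ?C h) ?C"
    have "?i \<one> = \<one>" "?i w = z"
      using h z inj closed inv_into_f_f [OF inj, of \<one>] by auto
    then have "?i \<in> \<Gamma> \<and> ?i \<one> = \<one> \<and> z = ?i w" using inv [OF h(1)] by simp
    then show ?thesis unfolding orb_def by blast
  qed
  have part: "is_partition_of (orb ` ?C) ?C"
    unfolding is_partition_of_def
  proof (intro conjI ballI impI)
    fix X assume "X \<in> orb ` ?C"
    then show "X \<noteq> {}" "X \<subseteq> ?C" using self orb_C by blast+
  next
    show "\<Union> (orb ` ?C) = ?C" using self orb_C by blast
  next
    fix X Y assume X: "X \<in> orb ` ?C" and Y: "Y \<in> orb ` ?C" and neq: "X \<noteq> Y"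
    have "Z = orb v" if "Z \<in> orb ` ?C" "v \<in> Z" for Z v
    proof -
      obtain z where z: "z \<in> ?C" "Z = orb z" using \<open>Z \<in> orb ` ?C\<close> by blast
      with \<open>v \<in> Z\<close> have "v \<in> orb z" "v \<in> ?C" using orb_C by auto
      with z step [of z v] step [of v z] sym [of z v] show ?thesis by auto
    qed
    with X Y neq show "X \<inter> Y = {}" by (metis disjoint_iff)
  qed
  have memA: "f \<in> A \<longleftrightarrow> (\<forall>z. z \<notin> ?C \<longrightarrow> f z = 0) \<and> (\<forall>X\<in>orb ` ?C. \<forall>z\<in>X. \<forall>w\<in>X. f z = f w)" for f
    unfolding span S by (rule mem_zspan_partition [OF part fin])
  have "ul (orb x) \<in> A"
    unfolding memA
  proof (intro conjI allI ballI impI)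
    fix X v w assume "X \<in> orb ` ?C" "v \<in> X" "w \<in> X"
    then have "v \<in> orb x \<longleftrightarrow> w \<in> orb x"
      using part x unfolding is_partition_of_def by blast
    then show "ul (orb x) v = ul (orb x) w" by (simp add: ul_def)
  qed (use orb_C [OF x] in \<open>auto simp: ul_def\<close>)
  then have "ul (orb x) x = ul (orb x) y" by (rule xy)
  with self [OF x] have "y \<in> orb x" by (simp add: ul_def split: if_splits)
  then obtain \<gamma> where \<gamma>: "\<gamma> \<in> \<Gamma>" "\<gamma> \<one> = \<one>" "\<gamma> x = y" by (auto simp: orb_def)
  have "\<gamma> w \<otimes> inv (\<gamma> z) \<in> X \<longleftrightarrow> w \<otimes> inv z \<in> X"
    if X: "ul X \<in> A" and z: "z \<in> ?C" and w: "w \<in> ?C" for X z w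
  proof -
    define \<rho> where "\<rho> g = (\<lambda>v\<in>?C. v \<otimes> g)" for g
    have \<rho>: "\<rho> g \<in> \<Gamma>" if "g \<in> ?C" for g using that right by (auto simp: right_regular_def \<rho>_def)
    \<comment> \<open>Framing \<open>\<gamma>\<close> by two right translations gives an element of
      \<open>\<Gamma>\<close> that fixes the identity and takes the quotient of \<open>w\<close> and
      \<open>z\<close> to the quotient of their images.\<close>
    define \<delta> where "\<delta> = compose ?C (\<rho> (inv (\<gamma> z))) (compose ?C \<gamma> (\<rho> z))"
    have \<gamma>C: "\<gamma> z \<in> ?C" "\<gamma> w \<in> ?C" using closed \<gamma> z w by auto
    have "\<delta> \<in> \<Gamma>" unfolding \<delta>_def using \<rho> comp \<gamma> z \<gamma>C by simp
    moreover have "\<delta> \<one> = \<one>" using z \<gamma>C by (simp add: \<delta>_def \<rho>_def compose_def)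
    ultimately have "\<delta> (w \<otimes> inv z) \<in> orb (w \<otimes> inv z)" by (auto simp: orb_def)
    moreover have "\<delta> (w \<otimes> inv z) = \<gamma> w \<otimes> inv (\<gamma> z)"
      using z w \<gamma>C by (simp add: \<delta>_def \<rho>_def compose_def m_assoc)
    moreover have "w \<otimes> inv z \<in> ?C" using z w by simp
    ultimately have "ul X (\<gamma> w \<otimes> inv (\<gamma> z)) = ul X (w \<otimes> inv z)"
      using X self unfolding memA by (metis imageI)
    then show ?thesis by (simp add: ul_def split: if_splits)
  qed
  then have "col_preserving G A \<gamma>"
    using bij \<gamma> by (auto simp: col_preserving_def)
  with \<gamma>(3) that show thesis by blast
qed

section \<open>The group of order 27\<close>

lemma mod3_cases: "(y :: int) mod 3 \<in> {0, 1, 2}"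
  by auto

lemma sum_int_3: "(\<Sum>l\<in>{0..<3 :: int}. f l) = f 0 + f 1 + f 2"
proof -
  have "{0..<3 :: int} = {0, 1, 2}" by auto
  then show ?thesis by (simp add: add.assoc)
qed

text \<open>
  Colour 2 is the eight-element basic set; together with colour 1 it is the connection set of the
  collinearity graph of the generalized quadrangle of order (2, 4), in which the cosets of the
  subgroup generated by \<open>b\<close> form a spread.
\<close>

definition col27 :: "int \<Rightarrow> int \<Rightarrow> nat" where
  "col27 k y = (if k mod 9 = 0 then (if y mod 3 = 0 then 0 else 1)
     else if (k mod 9, y mod 3) \<in> {(2, 0), (7, 0), (3, 0), (6, 0), (1, 1), (8, 1), (4, 2), (5, 2)}
     then 2 else 3)"

lemma col27_cong: "9 dvd k - l \<Longrightarrow> 3 dvd y - z \<Longrightarrow> col27 k y = col27 l z"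
  unfolding col27_def mod_eq_dvd_iff [symmetric] by simp

lemma col27_mod: "col27 (k mod 9) (y mod 3) = col27 k y"
  by (simp add: col27_def)

lemma col27_less: "col27 k y < 4"
  by (simp add: col27_def)

text \<open>One element of each colour, so that a function constant on colour classes can be read as
  a function of the colour.\<close>

definition rep27 :: "nat \<Rightarrow> int \<times> int" where
  "rep27 c = (if c = 0 then (0, 0) else if c = 1 then (0, 1) else if c = 2 then (2, 0) else (1, 0))"

lemma col27_rep: "c < 4 \<Longrightarrow> rep27 c = (k, y) \<Longrightarrow> col27 k y = c"
  by (auto simp: rep27_def col27_def split: if_splits)

lemma mod9_cases: "(k :: int) mod 9 \<in> {0, 1, 2, 3, 4, 5, 6, 7, 8}"
  by auto

lemma nine_dvd_cong:
  fixes k l y z :: int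
  assumes "9 dvd k - l" "3 dvd y - z"
  shows "9 dvd 3 * k * y - 3 * l * z"
proof -
  obtain s t where "k - l = 9 * s" "y - z = 3 * t" using assms by (elim dvdE)
  then have "k = l + 9 * s" "y = z + 3 * t" by simp_all
  then have "3 * k * y - 3 * l * z = 9 * (l * t + 3 * s * z + 9 * s * t)"
    by (simp add: algebra_simps)
  then show ?thesis by simp
qed

text \<open>By \<open>E_inv\<close> with \<open>m = 3\<close> the left side is the colour of the
  inverse. Reduction modulo 9 and 3 leaves 27 cases.\<close>

lemma col27_neg: "col27 (- k - 3 * k * y) (- y) = col27 k y"
proof -
  have all: "\<forall>k\<in>{0, 1, 2, 3, 4, 5, 6, 7, 8}. \<forall>y\<in>{0, 1, 2}. col27 (- k - 3 * k * y) (- y) = col27 k y"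
    by (simp add: col27_def)
  have "col27 (- k - 3 * k * y) (- y)
      = col27 (- (k mod 9) - 3 * (k mod 9) * (y mod 3)) (- (y mod 3))"
  proof (rule col27_cong)
    have "9 dvd k mod 9 - k" "3 dvd y mod 3 - y" by presburger+
    from dvd_add [OF this(1) nine_dvd_cong [OF this]]
    show "9 dvd - k - 3 * k * y - (- (k mod 9) - 3 * (k mod 9) * (y mod 3))"
      by (simp add: algebra_simps)
    show "3 dvd - y - - (y mod 3)" by presburger
  qed
  also have "\<dots> = col27 (k mod 9) (y mod 3)"
    using all mod9_cases [of k] mod3_cases [of y] by (metis (no_types))
  also have "\<dots> = col27 k y" by (rule col27_mod)
  finally show ?thesis .
qed

text \<open>The coefficients are the structure constants of the rank 4 S-ring.\<close>

definition conv27 :: "(nat \<Rightarrow> int) \<Rightarrow> (nat \<Rightarrow> int) \<Rightarrow> nat \<Rightarrow> int" where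
  "conv27 F H c =
    (if c = 0 then F 0 * H 0 + 2 * F 1 * H 1 + 8 * F 2 * H 2 + 16 * F 3 * H 3
     else if c = 1 then F 0 * H 1 + F 1 * H 0 + F 1 * H 1 + 8 * F 2 * H 3 + 8 * F 3 * H 2 + 8 * F 3 * H 3
     else if c = 2 then F 0 * H 2 + 2 * F 1 * H 3 + F 2 * H 0 + F 2 * H 2 + 6 * F 2 * H 3
       + 2 * F 3 * H 1 + 6 * F 3 * H 2 + 8 * F 3 * H 3
     else F 0 * H 3 + F 1 * H 2 + F 1 * H 3 + F 2 * H 1 + 3 * F 2 * H 2 + 4 * F 2 * H 3
       + F 3 * H 0 + F 3 * H 1 + 4 * F 3 * H 2 + 10 * F 3 * H 3)"

lemma sum_int_9: "(\<Sum>l\<in>{0..<9 :: int}. f l) = f 0 + f 1 + f 2 + f 3 + f 4 + f 5 + f 6 + f 7 + f 8"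
proof -
  have "{0..<9 :: int} = {0, 1, 2, 3, 4, 5, 6, 7, 8}" by auto
  then show ?thesis by (simp add: add.assoc)
qed

text \<open>The multiplication table of the colours, checked at all 27 elements with symbolic
  coefficients \<open>F\<close> and \<open>H\<close>.\<close>

lemma conv27_aux:
  "\<forall>k\<in>{0, 1, 2, 3, 4, 5, 6, 7, 8}. \<forall>y\<in>{0, 1, 2}.
    (\<Sum>l\<in>{0..<9}. \<Sum>z\<in>{0..<3}. F (col27 l z) * H (col27 (k - l + 3 * z * (k - l)) (y - z)))
    = conv27 F H (col27 k y)"
  unfolding sum_int_9 sum_int_3
  by (simp add: conv27_def col27_def)

lemma conv27:
  "(\<Sum>l\<in>{0..<9}. \<Sum>z\<in>{0..<3}. F (col27 l z) * H (col27 (k - l + 3 * z * (k - l)) (y - z)))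
    = conv27 F H (col27 k y)"
proof -
  have "col27 (k - l + 3 * z * (k - l)) (y - z)
      = col27 (k mod 9 - l + 3 * z * (k mod 9 - l)) (y mod 3 - z)" for l z
  proof (rule col27_cong)
    have "9 dvd (k - k mod 9) * (1 + 3 * z)" by (intro dvd_mult2) presburger
    then show "9 dvd k - l + 3 * z * (k - l) - (k mod 9 - l + 3 * z * (k mod 9 - l))"
      by (simp add: algebra_simps)
    show "3 dvd y - z - (y mod 3 - z)" by presburger
  qed
  then have "(\<Sum>l\<in>{0..<9}. \<Sum>z\<in>{0..<3}. F (col27 l z) * H (col27 (k - l + 3 * z * (k - l)) (y - z)))
    = (\<Sum>l\<in>{0..<9}. \<Sum>z\<in>{0..<3}. F (col27 l z) *
        H (col27 (k mod 9 - l + 3 * z * (k mod 9 - l)) (y mod 3 - z)))"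
    by simp
  also have "\<dots> = conv27 F H (col27 (k mod 9) (y mod 3))"
    using conv27_aux mod9_cases mod3_cases by blast
  finally show ?thesis by (simp only: col27_mod)
qed

text \<open>The colour of the quotient in \<open>E_div\<close> for \<open>m = 3\<close>.\<close>

definition dcol27 :: "int \<Rightarrow> int \<Rightarrow> int \<Rightarrow> int \<Rightarrow> nat" where
  "dcol27 k y l z = col27 (k - l + 3 * l * (y - z)) (y - z)"

text \<open>These lists bound the images under a permutation that fixes \<open>E 0 0\<close> and
  takes \<open>E 3 0\<close> to \<open>E 2 0\<close>. The first determines the image of
  \<open>E 6 0\<close>; the others give the two further points on the spread lines through
  \<open>E 0 0\<close>, \<open>E 2 0\<close> and \<open>E 4 2\<close>.\<close>

lemma dcol27_cases:
  "\<forall>p\<in>{0, 1, 2, 3, 4, 5, 6, 7, 8}. \<forall>q\<in>{0, 1, 2}.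
    dcol27 p q 0 0 = 2 \<and> dcol27 p q 2 0 = 2 \<longrightarrow> p = 4 \<and> q = 2"
  "\<forall>u\<in>{0, 1, 2, 3, 4, 5, 6, 7, 8}. \<forall>v\<in>{0, 1, 2}. dcol27 u v 0 0 = 1 \<longrightarrow> u = 0 \<and> (v = 1 \<or> v = 2)"
  "\<forall>r\<in>{0, 1, 2, 3, 4, 5, 6, 7, 8}. \<forall>s\<in>{0, 1, 2}.
    dcol27 r s 2 0 = 1 \<longrightarrow> (r = 5 \<and> s = 1) \<or> (r = 8 \<and> s = 2)"
  "\<forall>w\<in>{0, 1, 2, 3, 4, 5, 6, 7, 8}. \<forall>t\<in>{0, 1, 2}.
    dcol27 w t 4 2 = 1 \<longrightarrow> (w = 1 \<and> t = 0) \<or> (w = 7 \<and> t = 1)"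
  by (simp_all add: dcol27_def col27_def)

lemma dcol27_values:
  "dcol27 6 0 0 0 = 2" "dcol27 6 0 3 0 = 2" "dcol27 0 1 0 0 = 1" "dcol27 3 1 3 0 = 1"
  "dcol27 3 1 0 1 = 2" "dcol27 6 1 6 0 = 1" "dcol27 6 1 0 1 = 2" "dcol27 6 1 3 1 = 2"
  by (simp_all add: dcol27_def col27_def)

text \<open>Functions in the ring factor through the colour, so its closure properties reduce to
  \<open>col27_neg\<close> and \<open>conv27\<close>.\<close>

lemma (in modular_3_group) not_Schur_27:
  assumes m: "m = 3"
  shows "\<not> Schur_group G"
proof
  assume Schur: "Schur_group G"
  define Mv where "Mv = {(E k y, E l z) | k y l z. col27 k y = col27 l z}"
  let ?A = "move_ring G Mv"
  have rep: "\<exists>F. \<forall>k y. f (E k y) = F (col27 k y)" if "f \<in> ?A" for f :: "'a \<Rightarrow> int"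
  proof (intro exI allI)
    fix k y
    obtain l z where lz: "rep27 (col27 k y) = (l, z)" by force
    then have "(E k y, E l z) \<in> Mv"
      using col27_rep [OF col27_less lz] unfolding Mv_def by force
    with that have "f (E k y) = f (E l z)" by (auto simp: move_ring_def)
    then show "f (E k y) = (\<lambda>c. case rep27 c of (l, z) \<Rightarrow> f (E l z)) (col27 k y)"
      by (simp add: lz)
  qed
  have E_col: "col27 k y = col27 l z" if "E k y = E l z" for k y l z
    using that by (intro col27_cong) (simp_all add: E_eq_iff m)
  have ring: "is_S_ring G ?A"
  proof (rule is_S_ring_move_ring)
    show "Mv \<subseteq> carrier G \<times> carrier G" by (auto simp: Mv_def)
    fix x y assume xy: "(x, y) \<in> Mv"
    have one: "E k y = \<one> \<longleftrightarrow> col27 k y = 0" for k y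
      by (simp add: E_0_0 [symmetric] E_eq_iff m col27_def dvd_eq_mod_eq_0)
    show "x = \<one> \<longleftrightarrow> y = \<one>" using xy by (auto simp: Mv_def one)
    fix f assume f: "f \<in> ?A"
    obtain F where F: "\<And>k y. f (E k y) = F (col27 k y)" using rep [OF f] by blast
    show "f (inv x) = f (inv y)"
      using xy by (auto simp: Mv_def E_inv m F col27_neg)
    fix g assume g: "g \<in> ?A"
    obtain H where H: "\<And>k y. g (E k y) = H (col27 k y)" using rep [OF g] by blast
    show "gr_mult G f g x = gr_mult G f g y"
      using xy by (auto simp: Mv_def gr_mult_E m F H conv27)
  qed (rule finite_carrier)
  have colour: "ul {x. \<exists>k y. x = E k y \<and> col27 k y = c} \<in> ?A" for c
  proof (rule ul_mem_move_ring)
    fix x y assume "(x, y) \<in> Mv"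
    then obtain k z k' z' where xy: "x = E k z" "y = E k' z'" "col27 k z = col27 k' z'"
      by (auto simp: Mv_def)
    have "E k z \<in> {x. \<exists>k y. x = E k y \<and> col27 k y = c} \<longleftrightarrow> col27 k z = c" for k z
      using E_col by blast
    then show "x \<in> {x. \<exists>k y. x = E k y \<and> col27 k y = c} \<longleftrightarrow> y \<in> {x. \<exists>k y. x = E k y \<and> col27 k y = c}"
      unfolding xy using xy(3) by simp
  qed auto
  \<comment> \<open>Both \<open>c = a^3\<close> and \<open>a^2\<close> have colour 2.\<close>
  have swap: "f (E 3 0) = f (E 2 0)" if "f \<in> ?A" for f :: "'a \<Rightarrow> int"
    using rep [OF that] by (auto simp: col27_def)
  from Schur ring have "schurian G ?A" by (simp add: Schur_group_def)
  then obtain \<gamma> where \<gamma>: "col_preserving G ?A \<gamma>" and \<gamma>c: "\<gamma> (E 3 0) = E 2 0"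
    by (rule schurian_col_preserving [OF finite_carrier _ _ _ swap]) simp_all
  have diff: "dcol27 k' y' l' z' = dcol27 k y l z"
    if img: "\<gamma> (E k y) = E k' y'" "\<gamma> (E l z) = E l' z'" for k y l z k' y' l' z'
  proof -
    let ?X = "{x. \<exists>k' y'. x = E k' y' \<and> col27 k' y' = dcol27 k y l z}"
    have "E k y \<otimes> inv (E l z) \<in> ?X" unfolding E_div dcol27_def m by blast
    then have "\<gamma> (E k y) \<otimes> inv (\<gamma> (E l z)) \<in> ?X"
      by (simp only: col_preservingD [OF \<gamma> colour E_closed E_closed])
    then obtain i j where "E (k' - l' + 3 * l' * (y' - z')) (y' - z') = E i j"
        "col27 i j = dcol27 k y l z"
      unfolding img E_div m by blast
    then show ?thesis
      using E_col [of "k' - l' + 3 * l' * (y' - z')" "y' - z'" i j] by (simp add: dcol27_def)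
  qed
  have im: "\<exists>k'\<in>{0, 1, 2, 3, 4, 5, 6, 7, 8}. \<exists>y'\<in>{0, 1, 2}. \<gamma> (E k y) = E k' y'" for k y
  proof -
    obtain k' y' where "\<gamma> (E k y) = E k' y'"
      using E_exhaust [OF col_preserving_closed [OF \<gamma> E_closed]] by blast
    also have "\<dots> = E (k' mod 9) (y' mod 3)" by (rule E_cong) (simp_all add: m dvd_minus_mod)
    finally show ?thesis by (rule bexI [OF bexI [OF _ mod3_cases] mod9_cases])
  qed
  have \<gamma>1: "\<gamma> (E 0 0) = E 0 0" using \<gamma> by (simp add: col_preserving_def E_0_0)
  \<comment> \<open>The triangle \<open>1, c, c\<^sup>2\<close> is parallel to \<open>b, b c, b c\<^sup>2\<close>: the third points lie in one coset of
    the spread. The triangle on \<open>1, a\<^sup>2\<close> has no such parallel, so \<open>c\<close> cannot be moved to \<open>a\<^sup>2\<close>.\<close>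
  obtain p q where pq: "p \<in> {0, 1, 2, 3, 4, 5, 6, 7, 8}" "q \<in> {0, 1, 2}" "\<gamma> (E 6 0) = E p q"
    using im [of 6 0] by (elim bexE) (rule that)
  obtain u v where uv: "u \<in> {0, 1, 2, 3, 4, 5, 6, 7, 8}" "v \<in> {0, 1, 2}" "\<gamma> (E 0 1) = E u v"
    using im [of 0 1] by (elim bexE) (rule that)
  obtain r s where rs: "r \<in> {0, 1, 2, 3, 4, 5, 6, 7, 8}" "s \<in> {0, 1, 2}" "\<gamma> (E 3 1) = E r s"
    using im [of 3 1] by (elim bexE) (rule that)
  obtain w t where wt: "w \<in> {0, 1, 2, 3, 4, 5, 6, 7, 8}" "t \<in> {0, 1, 2}" "\<gamma> (E 6 1) = E w t"
    using im [of 6 1] by (elim bexE) (rule that)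
  have "p = 4 \<and> q = 2"
    using bspec [OF bspec [OF dcol27_cases(1) pq(1)] pq(2)] diff [OF pq(3) \<gamma>1] diff [OF pq(3) \<gamma>c]
    by (simp add: dcol27_values)
  moreover from this have "(w = 1 \<and> t = 0) \<or> (w = 7 \<and> t = 1)"
    using bspec [OF bspec [OF dcol27_cases(4) wt(1)] wt(2)] diff [OF wt(3) pq(3)]
    by (simp add: dcol27_values)
  moreover have "u = 0 \<and> (v = 1 \<or> v = 2)"
    using bspec [OF bspec [OF dcol27_cases(2) uv(1)] uv(2)] diff [OF uv(3) \<gamma>1]
    by (simp add: dcol27_values)
  moreover have "(r = 5 \<and> s = 1) \<or> (r = 8 \<and> s = 2)"
    using bspec [OF bspec [OF dcol27_cases(3) rs(1)] rs(2)] diff [OF rs(3) \<gamma>c]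
    by (simp add: dcol27_values)
  moreover have "dcol27 r s u v = 2" "dcol27 w t u v = 2" "dcol27 w t r s = 2"
    using diff [OF rs(3) uv(3)] diff [OF wt(3) uv(3)] diff [OF wt(3) rs(3)]
    by (simp_all add: dcol27_values)
  \<comment> \<open>Two candidates remain for each of the three images, and none of the eight
    choices gives colour 2 to all three pairs.\<close>
  ultimately show False by (elim disjE conjE) (simp_all add: dcol27_def col27_def)
qed

section \<open>Convolution of class functions\<close>

text \<open>Substitution in a sum over residues modulo 3; this is how the variables of a sum over a
  coset of \<open>H\<close> are translated later.\<close>

lemma sum3_shift:
  fixes h :: "int \<Rightarrow> int"
  assumes "\<And>x y. 3 dvd x - y \<Longrightarrow> h x = h y"
  shows "(\<Sum>x\<in>{0..<3}. h (x + s)) = (\<Sum>x\<in>{0..<3}. h x)"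
proof -
  have "h (x + s) = h (x + s mod 3)" for x by (rule assms) presburger
  moreover have "h 3 = h 0" "h 4 = h 1" by (rule assms; simp)+
  ultimately show ?thesis using mod3_cases [of s] by (auto simp: sum_int_3)
qed

lemma sum3_neg:
  fixes h :: "int \<Rightarrow> int"
  assumes "\<And>x y. 3 dvd x - y \<Longrightarrow> h x = h y"
  shows "(\<Sum>x\<in>{0..<3}. h (- x)) = (\<Sum>x\<in>{0..<3}. h x)"
proof -
  have "h (- 1) = h 2" "h (- 2) = h 1" by (rule assms; simp)+
  then show ?thesis by (simp add: sum_int_3)
qed

lemma sum33_shift:
  fixes g :: "int \<Rightarrow> int \<Rightarrow> int"
  assumes "\<And>x x' z z'. 3 dvd x - x' \<Longrightarrow> 3 dvd z - z' \<Longrightarrow> g x z = g x' z'"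
  shows "(\<Sum>x\<in>{0..<3}. \<Sum>z\<in>{0..<3}. g (x + s) (z + t)) = (\<Sum>x\<in>{0..<3}. \<Sum>z\<in>{0..<3}. g x z)"
proof -
  have "(\<Sum>x\<in>{0..<3}. \<Sum>z\<in>{0..<3}. g (x + s) (z + t)) = (\<Sum>x\<in>{0..<3}. \<Sum>z\<in>{0..<3}. g (x + s) z)"
    by (intro sum.cong sum3_shift refl assms) auto
  also have "\<dots> = (\<Sum>x\<in>{0..<3}. \<Sum>z\<in>{0..<3}. g x z)"
    by (rule sum3_shift) (intro sum.cong refl assms, auto)
  finally show ?thesis .
qed

lemma sum33_neg:
  fixes g :: "int \<Rightarrow> int \<Rightarrow> int"
  assumes "\<And>x x' z z'. 3 dvd x - x' \<Longrightarrow> 3 dvd z - z' \<Longrightarrow> g x z = g x' z'"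
  shows "(\<Sum>x\<in>{0..<3}. \<Sum>z\<in>{0..<3}. g (- x) (- z)) = (\<Sum>x\<in>{0..<3}. \<Sum>z\<in>{0..<3}. g x z)"
proof -
  have "(\<Sum>x\<in>{0..<3}. \<Sum>z\<in>{0..<3}. g (- x) (- z)) = (\<Sum>x\<in>{0..<3}. \<Sum>z\<in>{0..<3}. g (- x) z)"
    by (intro sum.cong sum3_neg refl assms) auto
  also have "\<dots> = (\<Sum>x\<in>{0..<3}. \<Sum>z\<in>{0..<3}. g x z)"
    by (rule sum3_neg) (intro sum.cong refl assms, auto)
  finally show ?thesis .
qed

text \<open>
  A function on the group is studied through \<open>\<phi> k y = f (a\<^sup>k b\<^sup>y)\<close>. As \<open>a\<^sup>m\<close> is the central commutator
  \<open>c\<close>, the coset \<open>a\<^sup>k H\<close> of \<open>H = \<langle>c, b\<rangle>\<close> consists of the points \<open>(k + m x, y)\<close>.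
\<close>

definition periodic :: "int \<Rightarrow> (int \<Rightarrow> int \<Rightarrow> int) \<Rightarrow> bool" where
  "periodic m \<phi> \<longleftrightarrow> (\<forall>k l y z. 3 * m dvd k - l \<longrightarrow> 3 dvd y - z \<longrightarrow> \<phi> k y = \<phi> l z)"

lemma periodicD: "periodic m \<phi> \<Longrightarrow> 3 * m dvd k - l \<Longrightarrow> 3 dvd y - z \<Longrightarrow> \<phi> k y = \<phi> l z"
  by (simp add: periodic_def)

text \<open>Invariance on the coset \<open>a^j H\<close> under right multiplication by
  \<open>c^p b^q\<close>.\<close>

definition shift_inv :: "int \<Rightarrow> (int \<Rightarrow> int \<Rightarrow> int) \<Rightarrow> int \<Rightarrow> int \<Rightarrow> int \<Rightarrow> bool" where
  "shift_inv m \<phi> j p q \<longleftrightarrow> (\<forall>x y. \<phi> (j + m * (x + p)) (y + q) = \<phi> (j + m * x) y)"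

text \<open>The reflection exchanges \<open>a^j h\<close> and \<open>a^j h^-1\<close> for
  \<open>h\<close> in \<open>H\<close>.\<close>

definition reflect_inv :: "int \<Rightarrow> (int \<Rightarrow> int \<Rightarrow> int) \<Rightarrow> int \<Rightarrow> bool" where
  "reflect_inv m \<phi> j \<longleftrightarrow> (\<forall>x y. \<phi> (j + m * x) y = \<phi> (j - m * x) (- y))"

lemma shift_inv_add:
  assumes "shift_inv m \<phi> j p q" "shift_inv m \<phi> j p' q'"
  shows "shift_inv m \<phi> j (p + p') (q + q')"
  unfolding shift_inv_def
proof (intro allI)
  fix x y
  have "\<phi> (j + m * (x + p + p')) (y + q + q') = \<phi> (j + m * (x + p)) (y + q)"
    using assms(2) by (simp only: shift_inv_def)
  also have "\<dots> = \<phi> (j + m * x) y" using assms(1) by (simp only: shift_inv_def)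
  finally show "\<phi> (j + m * (x + (p + p'))) (y + (q + q')) = \<phi> (j + m * x) y"
    by (simp only: add.assoc)
qed

lemma shift_inv_neg:
  assumes "shift_inv m \<phi> j p q"
  shows "shift_inv m \<phi> j (- p) (- q)"
  unfolding shift_inv_def
proof (intro allI)
  fix x y
  have "\<phi> (j + m * (x - p + p)) (y - q + q) = \<phi> (j + m * (x - p)) (y - q)"
    using assms by (simp only: shift_inv_def)
  then show "\<phi> (j + m * (x + - p)) (y + - q) = \<phi> (j + m * x) y" by simp
qed

lemma shift_inv_mult:
  assumes "shift_inv m \<phi> j p q"
  shows "shift_inv m \<phi> j (t * p) (t * q)"
proof (induction t rule: int_induct [where k = 0])
  case base
  show ?case by (simp add: shift_inv_def)
next
  case (step1 i)
  from shift_inv_add [OF this(2) assms] show ?case by (simp add: algebra_simps)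
next
  case (step2 i)
  from shift_inv_add [OF this(2) shift_inv_neg [OF assms]] show ?case by (simp add: algebra_simps)
qed

lemma shift_inv_full:
  assumes "shift_inv m \<phi> j 1 0" "shift_inv m \<phi> j 0 1"
  shows "shift_inv m \<phi> j p q"
  using shift_inv_add [OF shift_inv_mult [OF assms(1), of p] shift_inv_mult [OF assms(2), of q]]
  by simp

text \<open>Another base point in the same coset merely renames \<open>x\<close>, so shifts, unlike
  reflections, depend on the coset alone.\<close>

lemma shift_inv_cong:
  assumes per: "periodic m \<phi>" and inv: "shift_inv m \<phi> j p q"
    and "3 dvd p - p'" "3 dvd q - q'" "m dvd j - j'"
  shows "shift_inv m \<phi> j' p' q'"
  unfolding shift_inv_def
proof (intro allI)
  fix x y
  obtain t where "j - j' = m * t" using assms(5) ..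
  then have j': "j' = j - m * t" by simp
  have "\<phi> (j' + m * (x + p')) (y + q') = \<phi> (j + m * (x - t + p)) (y + q)"
  proof (rule periodicD [OF per])
    have "3 * m dvd (p' - p) * m"
      using assms(3) by (intro mult_dvd_mono) (auto simp: dvd_diff_commute)
    then show "3 * m dvd (j' + m * (x + p')) - (j + m * (x - t + p))"
      by (simp add: j' algebra_simps)
    show "3 dvd (y + q') - (y + q)" using assms(4) by presburger
  qed
  also have "\<dots> = \<phi> (j + m * (x - t)) y" using inv by (simp only: shift_inv_def)
  finally show "\<phi> (j' + m * (x + p')) (y + q') = \<phi> (j' + m * x) y"
    by (simp add: j' algebra_simps)
qed

text \<open>The part of the convolution where the left factor is restricted to the coset \<open>a\<^sup>i H\<close>.\<close>

definition layer :: "int \<Rightarrow> (int \<Rightarrow> int \<Rightarrow> int) \<Rightarrow> (int \<Rightarrow> int \<Rightarrow> int) \<Rightarrow> int \<Rightarrow> int \<Rightarrow> int \<Rightarrow> int" where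
  "layer m \<phi> \<psi> i k y = (\<Sum>x\<in>{0..<3}. \<Sum>z\<in>{0..<3}.
     \<phi> (i + m * x) z * \<psi> (k - i - m * x + m * z * (k - i)) (y - z))"

section \<open>Symmetries of one layer of a convolution\<close>

context
  fixes m :: int and \<phi> \<psi> :: "int \<Rightarrow> int \<Rightarrow> int"
  assumes m3: "3 dvd m" and periodic_left: "periodic m \<phi>" and periodic_right: "periodic m \<psi>"
begin

lemma three_m_dvd_diff: "3 dvd u - v \<Longrightarrow> 3 * m dvd m * u - m * v" for u v :: int
proof -
  assume "3 dvd u - v"
  then have "3 * m dvd (u - v) * m" by (intro mult_dvd_mono) auto
  then show ?thesis by (simp add: algebra_simps)
qed

lemma layer_summand_cong:
  assumes "3 dvd x - x'" "3 dvd z - z'"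
  shows "\<phi> (i + m * x) z * \<psi> (k - i - m * x + m * z * (k - i)) (y - z)
    = \<phi> (i + m * x') z' * \<psi> (k - i - m * x' + m * z' * (k - i)) (y - z')"
proof (intro arg_cong2 [where f = "(*)"])
  have *: "3 * m dvd m * x - m * x'" using assms(1) by (rule three_m_dvd_diff)
  show "\<phi> (i + m * x) z = \<phi> (i + m * x') z'"
    using * assms(2) by (intro periodicD [OF periodic_left]) simp_all
  have "3 dvd (z - z') * (k - i) - (x - x')" by (rule dvd_diff [OF dvd_mult2 [OF assms(2)] assms(1)])
  then have "3 * m dvd m * (z * (k - i) - x) - m * (z' * (k - i) - x')"
    by (intro three_m_dvd_diff) (simp add: algebra_simps)
  then show "\<psi> (k - i - m * x + m * z * (k - i)) (y - z) = \<psi> (k - i - m * x' + m * z' * (k - i)) (y - z')"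
    using assms(2) by (intro periodicD [OF periodic_right]) (auto simp: algebra_simps dvd_diff_commute)
qed

lemma layer_shift:
  "layer m \<phi> \<psi> i k y = (\<Sum>x\<in>{0..<3}. \<Sum>z\<in>{0..<3}. \<phi> (i + m * (x + s)) (z + t)
     * \<psi> (k - i - m * (x + s) + m * (z + t) * (k - i)) (y - (z + t)))"
  unfolding layer_def
  by (rule sum33_shift [symmetric]) (rule layer_summand_cong)

text \<open>Changing the representative translates \<open>x\<close>; the remaining error is a
  multiple of \<open>m * m\<close>.\<close>

lemma layer_cong:
  assumes "m dvd i - i'"
  shows "layer m \<phi> \<psi> i k y = layer m \<phi> \<psi> i' k y"
proof -
  obtain t where "i - i' = m * t" using assms ..
  then have i: "i' = i - m * t" by simp
  have "layer m \<phi> \<psi> i' k y = (\<Sum>x\<in>{0..<3}. \<Sum>z\<in>{0..<3}. \<phi> (i' + m * (x + t)) (z + 0)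
     * \<psi> (k - i' - m * (x + t) + m * (z + 0) * (k - i')) (y - (z + 0)))"
    by (rule layer_shift)
  also have "\<dots> = layer m \<phi> \<psi> i k y"
    unfolding layer_def
  proof (intro sum.cong refl arg_cong2 [where f = "(*)"])
    fix x z :: int
    show "\<phi> (i' + m * (x + t)) (z + 0) = \<phi> (i + m * x) z" by (simp add: i algebra_simps)
    have "3 * m dvd m * (m * (z * t)) - m * 0" using m3 by (intro three_m_dvd_diff) simp
    then show "\<psi> (k - i' - m * (x + t) + m * (z + 0) * (k - i')) (y - (z + 0))
      = \<psi> (k - i - m * x + m * z * (k - i)) (y - z)"
      by (intro periodicD [OF periodic_right]) (simp_all add: i algebra_simps)
  qed
  finally show ?thesis by simp
qed

text \<open>Right multiplication of the right factor is right multiplication of the product, so the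
  vector is unchanged.\<close>

lemma layer_shift_right:
  assumes "shift_inv m \<psi> (k - i) p q"
  shows "shift_inv m (layer m \<phi> \<psi> i) k p q"
  unfolding shift_inv_def
proof (intro allI)
  fix X Y
  show "layer m \<phi> \<psi> i (k + m * (X + p)) (Y + q) = layer m \<phi> \<psi> i (k + m * X) Y"
    unfolding layer_def
  proof (intro sum.cong refl arg_cong2 [where f = "(*)"])
    fix x z :: int
    have "3 * m dvd m * (m * (z * p)) - m * 0" using m3 by (intro three_m_dvd_diff) simp
    then have "\<psi> (k + m * (X + p) - i - m * x + m * z * (k + m * (X + p) - i)) (Y + q - z)
      = \<psi> ((k - i) + m * ((X - x + z * (k + m * X - i)) + p)) ((Y - z) + q)"
      by (intro periodicD [OF periodic_right]) (simp_all add: algebra_simps)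
    also have "\<dots> = \<psi> ((k - i) + m * (X - x + z * (k + m * X - i))) (Y - z)"
      using assms by (simp only: shift_inv_def)
    also have "\<dots> = \<psi> (k + m * X - i - m * x + m * z * (k + m * X - i)) (Y - z)"
      by (simp add: algebra_simps)
    finally show "\<psi> (k + m * (X + p) - i - m * x + m * z * (k + m * (X + p) - i)) (Y + q - z)
      = \<psi> (k + m * X - i - m * x + m * z * (k + m * X - i)) (Y - z)" .
  qed
qed

text \<open>Here \<open>c^p b^q\<close> must be moved to the right past \<open>a^(k-i)\<close>,
  which changes the power of \<open>c\<close> by \<open>- q * (k - i)\<close>.\<close>

lemma layer_shift_left:
  assumes "shift_inv m \<phi> i p q"
  shows "shift_inv m (layer m \<phi> \<psi> i) k (p - q * (k - i)) q"
  unfolding shift_inv_def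
proof (intro allI)
  fix X Y
  let ?P = "p - q * (k - i)"
  have "layer m \<phi> \<psi> i (k + m * (X + ?P)) (Y + q) = (\<Sum>x\<in>{0..<3}. \<Sum>z\<in>{0..<3}.
      \<phi> (i + m * (x + p)) (z + q)
     * \<psi> (k + m * (X + ?P) - i - m * (x + p) + m * (z + q) * (k + m * (X + ?P) - i)) (Y + q - (z + q)))"
    by (rule layer_shift)
  also have "\<dots> = layer m \<phi> \<psi> i (k + m * X) Y"
    unfolding layer_def
  proof (intro sum.cong refl arg_cong2 [where f = "(*)"])
    fix x z :: int
    show "\<phi> (i + m * (x + p)) (z + q) = \<phi> (i + m * x) z"
      using assms by (simp only: shift_inv_def)
    have "3 * m dvd m * (m * ((z + q) * (X + ?P) - z * X)) - m * 0" using m3 by (intro three_m_dvd_diff) simp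
    then show "\<psi> (k + m * (X + ?P) - i - m * (x + p) + m * (z + q) * (k + m * (X + ?P) - i)) (Y + q - (z + q))
      = \<psi> (k + m * X - i - m * x + m * z * (k + m * X - i)) (Y - z)"
      by (intro periodicD [OF periodic_right]) (simp_all add: algebra_simps)
  qed
  finally show "layer m \<phi> \<psi> i (k + m * (X + ?P)) (Y + q) = layer m \<phi> \<psi> i (k + m * X) Y" .
qed

text \<open>As \<open>H\<close> is normal and abelian, inverting the \<open>H\<close>-parts of
  \<open>a^i h\<close> and \<open>a^(k-i) h'\<close> inverts the \<open>H\<close>-part of their
  product.\<close>

lemma layer_reflect:
  assumes "reflect_inv m \<phi> i" "reflect_inv m \<psi> (k - i)"
  shows "reflect_inv m (layer m \<phi> \<psi> i) k"
  unfolding reflect_inv_def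
proof (intro allI)
  fix X Y
  have "layer m \<phi> \<psi> i (k - m * X) (- Y) = (\<Sum>x\<in>{0..<3}. \<Sum>z\<in>{0..<3}.
      \<phi> (i + m * (- x)) (- z) * \<psi> (k - m * X - i - m * (- x) + m * (- z) * (k - m * X - i)) (- Y - (- z)))"
    unfolding layer_def
    by (rule sum33_neg [symmetric]) (rule layer_summand_cong)
  also have "\<dots> = layer m \<phi> \<psi> i (k + m * X) Y"
    unfolding layer_def
  proof (intro sum.cong refl arg_cong2 [where f = "(*)"])
    fix x z :: int
    show "\<phi> (i + m * (- x)) (- z) = \<phi> (i + m * x) z"
      using assms(1) by (simp add: reflect_inv_def)
    have *: "3 * m dvd m * (m * (z * X * u)) - m * 0" for u using m3 by (intro three_m_dvd_diff) simp
    have "\<psi> (k + m * X - i - m * x + m * z * (k + m * X - i)) (Y - z)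
      = \<psi> ((k - i) + m * (X - x + z * (k - i))) (Y - z)"
      using * [of 1] by (intro periodicD [OF periodic_right]) (simp_all add: algebra_simps)
    also have "\<dots> = \<psi> ((k - i) - m * (X - x + z * (k - i))) (- (Y - z))"
      using assms(2) by (simp only: reflect_inv_def)
    also have "\<dots> = \<psi> (k - m * X - i - m * (- x) + m * (- z) * (k - m * X - i)) (- Y - (- z))"
      using * [of "- 1"] by (intro periodicD [OF periodic_right]) (simp_all add: algebra_simps)
    finally show "\<psi> (k - m * X - i - m * (- x) + m * (- z) * (k - m * X - i)) (- Y - (- z))
      = \<psi> (k + m * X - i - m * x + m * z * (k + m * X - i)) (Y - z)" by simp
  qed
  finally show "layer m \<phi> \<psi> i (k + m * X) Y = layer m \<phi> \<psi> i (k - m * X) (- Y)" by simp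
qed

lemma periodic_layer: "periodic m (layer m \<phi> \<psi> i)"
  unfolding periodic_def
proof (intro allI impI)
  fix k l y z assume kl: "3 * m dvd k - l" and yz: "3 dvd y - (z :: int)"
  show "layer m \<phi> \<psi> i k y = layer m \<phi> \<psi> i l z"
    unfolding layer_def
  proof (intro sum.cong refl arg_cong2 [where f = "(*)"] periodicD [OF periodic_right])
    fix x v :: int
    have "3 * m dvd (k - l) * (1 + m * v)" using kl by (rule dvd_mult2)
    then show "3 * m dvd k - i - m * x + m * v * (k - i) - (l - i - m * x + m * v * (l - i))"
      by (simp add: algebra_simps)
    show "3 dvd y - v - (z - v)" using yz by simp
  qed
qed

end

text \<open>The coset \<open>a^k H\<close> is none of \<open>H\<close>, \<open>a H\<close> and
  \<open>a^-1 H\<close>.\<close>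

definition generic :: "int \<Rightarrow> int \<Rightarrow> bool" where
  "generic m k \<longleftrightarrow> \<not> m dvd k \<and> \<not> m dvd k - 1 \<and> \<not> m dvd k + 1"

text \<open>
  Reflections depend on the representative \<open>k\<close> modulo \<open>3 m\<close>, not only on the coset \<open>a\<^sup>k H\<close>, hence the
  distinguished representatives \<open>0, 1, - 1\<close>; on the other cosets the shift by \<open>c\<close> makes the
  choice irrelevant.
\<close>

definition centred :: "int \<Rightarrow> int \<Rightarrow> bool" where
  "centred m k \<longleftrightarrow> k = 0 \<or> k = 1 \<or> k = - 1 \<or> generic m k"

text \<open>
  The slopes at \<open>k \<equiv> 1\<close> and \<open>k \<equiv> - 1\<close> are those of the coset \<open>a B\<close> and of its inverse
  \<open>B a\<inverse> = a\<inverse> (a B a\<inverse>)\<close>, where \<open>a b a\<inverse> = b c\<close>.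
\<close>

definition slope :: "int \<Rightarrow> int \<Rightarrow> int \<Rightarrow> int \<Rightarrow> bool" where
  "slope m k p q \<longleftrightarrow> generic m k \<and> p = 1 \<and> q = 0 \<or> m dvd k - 1 \<and> p = 0 \<and> q = 1 \<or>
     m dvd k + 1 \<and> p = 1 \<and> q = 1 \<or> generic m k \<and> \<not> 3 dvd k \<and> p = 0 \<and> q = 1"

text \<open>Constancy on the basic sets: only a reflection acts on \<open>H\<close>, a reflection
  and one direction of shifts on \<open>a H\<close> and \<open>a^-1 H\<close>, and at least the
  shifts by \<open>c\<close> on generic cosets.\<close>

definition class_fun :: "int \<Rightarrow> (int \<Rightarrow> int \<Rightarrow> int) \<Rightarrow> bool" where
  "class_fun m \<phi> \<longleftrightarrow> periodic m \<phi> \<and> (\<forall>k. centred m k \<longrightarrow> reflect_inv m \<phi> k) \<and>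
     (\<forall>k p q. slope m k p q \<longrightarrow> shift_inv m \<phi> k p q)"

section \<open>Layers of a product of two class functions\<close>

context
  fixes m :: int and \<phi> \<psi> :: "int \<Rightarrow> int \<Rightarrow> int" and i k :: int
  assumes m9: "9 dvd m" and m_pos: "0 < m"
    and cls\<phi>: "class_fun m \<phi>" and cls\<psi>: "class_fun m \<psi>"
begin

lemma class_three_dvd: "3 dvd m" using m9 by (rule dvd_trans [rotated]) simp

lemma class_not_dvd: "\<not> m dvd 1" "\<not> m dvd 2" "\<not> m dvd 3"
proof -
  have "9 \<le> m" using m9 m_pos by (rule zdvd_imp_le)
  then show "\<not> m dvd 1" "\<not> m dvd 2" "\<not> m dvd 3" by (auto dest: zdvd_imp_le)
qed

lemma class_periodic: "periodic m \<phi>" "periodic m \<psi>"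
  using cls\<phi> cls\<psi> by (simp_all add: class_fun_def)

lemma class_layer_periodic: "periodic m (layer m \<phi> \<psi> i)"
  by (rule periodic_layer [OF class_three_dvd class_periodic])

lemma class_shift_left: "slope m j p q \<Longrightarrow> shift_inv m \<phi> j p q"
  and class_shift_right: "slope m j p q \<Longrightarrow> shift_inv m \<psi> j p q"
  using cls\<phi> cls\<psi> by (simp_all add: class_fun_def)

lemma layer_slope_left: "slope m i p q \<Longrightarrow> shift_inv m (layer m \<phi> \<psi> i) k (p - q * (k - i)) q"
  by (rule layer_shift_left [OF class_three_dvd class_periodic]) (rule class_shift_left)

lemma layer_slope_right: "slope m (k - i) p q \<Longrightarrow> shift_inv m (layer m \<phi> \<psi> i) k p q"
  by (rule layer_shift_right [OF class_three_dvd class_periodic]) (rule class_shift_right)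

text \<open>If a factor lives on a generic coset, its invariance under the central \<open>c\<close>
  is inherited. Otherwise both factors lie over \<open>a H\<close>, or both over
  \<open>a^-1 H\<close>, and the shifts inherited from left and right differ by a generator of
  \<open>C\<close>.\<close>

lemma layer_shift_horizontal:
  assumes "generic m i \<or> generic m (k - i) \<or> generic m k"
  shows "shift_inv m (layer m \<phi> \<psi> i) k 1 0"
proof (cases "generic m i \<or> generic m (k - i)")
  case True
  then show ?thesis using layer_slope_left [of 1 0] layer_slope_right [of 1 0] by (auto simp: slope_def)
next
  case False
  then have k: "generic m k" and ni: "\<not> generic m i" and nk: "\<not> generic m (k - i)"
    using assms by auto
  have "\<not> m dvd i"
  proof
    assume i: "m dvd i"
    from nk consider "m dvd k - i" | "m dvd k - i - 1" | "m dvd k - i + 1"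
      by (auto simp: generic_def)
    then show False
      using k dvd_add [OF _ i, of "k - i"] dvd_add [OF _ i, of "k - i - 1"] dvd_add [OF _ i, of "k - i + 1"]
      by cases (simp_all add: generic_def)
  qed
  moreover have "\<not> m dvd k - i"
  proof
    assume "m dvd k - i"
    with ni k show False using dvd_add [of m "k - i" i] dvd_add [of m "k - i" "i - 1"]
        dvd_add [of m "k - i" "i + 1"] by (auto simp: generic_def)
  qed
  ultimately consider "m dvd i - 1" "m dvd k - i - 1" | "m dvd i + 1" "m dvd k - i + 1"
    using ni nk k dvd_add [of m "i - 1" "k - i + 1"] dvd_add [of m "i + 1" "k - i - 1"]
    by (auto simp: generic_def)
  then show ?thesis
  proof cases
    case 1
    then have "shift_inv m (layer m \<phi> \<psi> i) k (- (k - i)) 1" "shift_inv m (layer m \<phi> \<psi> i) k 0 1"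
      using layer_slope_left [of 0 1] layer_slope_right [of 0 1] by (simp_all add: slope_def)
    \<comment> \<open>The difference of the two vectors is \<open>(k - i, 0)\<close>, and
      \<open>k - i\<close> is 1 modulo 3.\<close>
    from shift_inv_add [OF this(2) shift_inv_neg [OF this(1)]]
    show ?thesis
      by (rule shift_inv_cong [OF class_layer_periodic]) (use dvd_trans [OF class_three_dvd 1(2)] in simp_all)
  next
    case 2
    then have "shift_inv m (layer m \<phi> \<psi> i) k (1 - (k - i)) 1" "shift_inv m (layer m \<phi> \<psi> i) k 1 1"
      using layer_slope_left [of 1 1] layer_slope_right [of 1 1] by (simp_all add: slope_def)
    from shift_inv_add [OF this(1) shift_inv_neg [OF this(2)]]
    show ?thesis
      by (rule shift_inv_cong [OF class_layer_periodic]) (use dvd_trans [OF class_three_dvd 2(2)] in \<open>simp_all, presburger\<close>)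
  qed
qed

text \<open>One of \<open>i\<close> and \<open>k - i\<close> is prime to 3, and its coset has a
  shift with \<open>q = 1\<close>. Together with the shift by \<open>c\<close> this generates all
  shifts.\<close>

lemma layer_shift_full:
  assumes gen: "generic m i \<or> generic m (k - i) \<or> generic m k" and k: "\<not> 3 dvd k"
  shows "shift_inv m (layer m \<phi> \<psi> i) k p q"
proof -
  have sl: "\<exists>p. slope m j p 1" if "\<not> 3 dvd j" for j
  proof -
    have "\<not> m dvd j" using that class_three_dvd dvd_trans by blast
    then show ?thesis using that by (auto simp: slope_def generic_def)
  qed
  have "\<not> 3 dvd i \<or> \<not> 3 dvd k - i" using k by presburger
  then obtain t where t: "shift_inv m (layer m \<phi> \<psi> i) k t 1"
    using sl layer_slope_left layer_slope_right by blast
  have h: "shift_inv m (layer m \<phi> \<psi> i) k 1 0" by (rule layer_shift_horizontal [OF gen])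
  from shift_inv_add [OF t shift_inv_mult [OF h, of "- t"]]
  have "shift_inv m (layer m \<phi> \<psi> i) k 0 1" by simp
  with h show ?thesis by (rule shift_inv_full)
qed

text \<open>When no generic coset is involved, one factor lies over \<open>H\<close> and the other
  over the coset of \<open>k\<close>, whose shift direction passes to the product unchanged modulo
  3.\<close>

lemma layer_slope:
  assumes "slope m k p q"
  shows "shift_inv m (layer m \<phi> \<psi> i) k p q"
proof (cases "generic m i \<or> generic m (k - i) \<or> generic m k")
  case True
  show ?thesis
  proof (cases "3 dvd k")
    case False
    with True show ?thesis by (rule layer_shift_full)
  next
    case True
    have "\<not> m dvd k - 1" "\<not> m dvd k + 1"
    proof -
      have "\<not> 3 dvd k - 1" "\<not> 3 dvd k + 1" using True by presburger+
      then show "\<not> m dvd k - 1" "\<not> m dvd k + 1" using dvd_trans [OF class_three_dvd] by blast+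
    qed
    with assms True layer_shift_horizontal show ?thesis by (auto simp: slope_def)
  qed
next
  case False
  then have ni: "\<not> generic m i" and nk: "\<not> generic m (k - i)" and "\<not> generic m k" by auto
  with assms consider (1) "m dvd k - 1" "p = 0" "q = 1" | (2) "m dvd k + 1" "p = 1" "q = 1"
    by (auto simp: slope_def)
  then show ?thesis
  proof cases
    case 1
    have "m dvd i \<or> m dvd k - i"
    proof (rule ccontr)
      assume neg: "\<not> (m dvd i \<or> m dvd k - i)"
      then have "\<not> m dvd i - 1" using dvd_diff [OF 1(1), of "i - 1"] by auto
      with neg ni have i: "m dvd i + 1" by (simp add: generic_def)
      have "\<not> m dvd k - i - 1" using neg dvd_diff [OF 1(1), of "k - i - 1"] by auto
      with neg nk have "m dvd k - i + 1" by (simp add: generic_def)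
      \<comment> \<open>Two factors over \<open>a^-1 H\<close> would give \<open>m dvd 3\<close>;
        this is where \<open>m = 3\<close> has to be excluded.\<close>
      from dvd_diff [OF dvd_add [OF i this] 1(1)] show False using class_not_dvd by simp
    qed
    then show ?thesis
    proof
      assume i: "m dvd i"
      have "m dvd k - i - 1" using dvd_diff [OF 1(1) i] by (simp add: algebra_simps)
      then show ?thesis using layer_slope_right [of 0 1] 1 by (simp add: slope_def)
    next
      assume ki: "m dvd k - i"
      then have "m dvd i - 1" using dvd_diff [OF 1(1) ki] by simp
      then have "shift_inv m (layer m \<phi> \<psi> i) k (- (k - i)) 1"
        using layer_slope_left [of 0 1] by (simp add: slope_def)
      then show ?thesis
        by (rule shift_inv_cong [OF class_layer_periodic]) (use 1 dvd_trans [OF class_three_dvd ki] in \<open>simp_all add: dvd_diff_commute\<close>)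
    qed
  next
    case 2
    have "m dvd i \<or> m dvd k - i"
    proof (rule ccontr)
      assume neg: "\<not> (m dvd i \<or> m dvd k - i)"
      then have "\<not> m dvd i + 1" using dvd_diff [OF 2(1), of "i + 1"] by auto
      with neg ni have i: "m dvd i - 1" by (simp add: generic_def)
      have "\<not> m dvd k - i + 1" using neg dvd_diff [OF 2(1), of "k - i + 1"] by auto
      with neg nk have "m dvd k - i - 1" by (simp add: generic_def)
      from dvd_diff [OF 2(1) dvd_add [OF i this]] show False using class_not_dvd by simp
    qed
    then show ?thesis
    proof
      assume i: "m dvd i"
      have "m dvd k - i + 1" using dvd_diff [OF 2(1) i] by (simp add: algebra_simps)
      then show ?thesis using layer_slope_right [of 1 1] 2 by (simp add: slope_def)
    next
      assume ki: "m dvd k - i"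
      then have "m dvd i + 1" using dvd_diff [OF 2(1) ki] by (simp add: add.commute)
      then have "shift_inv m (layer m \<phi> \<psi> i) k (1 - (k - i)) 1"
        using layer_slope_left [of 1 1] by (simp add: slope_def)
      then show ?thesis
        by (rule shift_inv_cong [OF class_layer_periodic]) (use 2 dvd_trans [OF class_three_dvd ki] in \<open>simp_all add: dvd_diff_commute\<close>)
    qed
  qed
qed

text \<open>A layer depends only on the coset of \<open>i\<close>, so it suffices to find a
  representative \<open>i'\<close> for which both factors are reflected about centred
  points.\<close>

lemma layer_centred:
  assumes "m dvd i - i'" "centred m i'" "centred m (k - i')"
  shows "reflect_inv m (layer m \<phi> \<psi> i) k"
proof -
  have "layer m \<phi> \<psi> i = layer m \<phi> \<psi> i'"
    by (intro ext layer_cong [OF class_three_dvd class_periodic assms(1)])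
  moreover have "reflect_inv m \<phi> i'" "reflect_inv m \<psi> (k - i')"
    using cls\<phi> cls\<psi> assms by (simp_all add: class_fun_def)
  ultimately show ?thesis using layer_reflect [OF class_three_dvd class_periodic] by simp
qed

text \<open>If \<open>k\<close> is generic and prime to 3, the layer is constant on the coset. In
  the other cases \<open>k\<close> is split into two centred summands.\<close>

lemma layer_reflect_centred:
  assumes "centred m k"
  shows "reflect_inv m (layer m \<phi> \<psi> i) k"
proof (cases "generic m k \<and> \<not> 3 dvd k")
  case True
  then have sh: "shift_inv m (layer m \<phi> \<psi> i) k p q" for p q by (intro layer_shift_full) auto
  have "layer m \<phi> \<psi> i (k + m * (0 + p)) (0 + q) = layer m \<phi> \<psi> i (k + m * 0) 0" for p q
    using sh [of p q] by (simp only: shift_inv_def)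
  then have "layer m \<phi> \<psi> i (k + m * p) q = layer m \<phi> \<psi> i k 0" for p q by simp
  from this [of _ _] this [of "- _" _] show ?thesis by (simp add: reflect_inv_def)
next
  case False
  \<comment> \<open>These are the partners of \<open>- 1\<close> and \<open>1\<close> in the
    splittings of \<open>k = 1\<close> and \<open>k = - 1\<close>.\<close>
  have two: "generic m 2" "generic m (- 2)" using class_not_dvd by (simp_all add: generic_def)
  from False assms consider "k = 0" | "k = 1" | "k = - 1" | "generic m k" "3 dvd k"
    by (auto simp: centred_def)
  then show ?thesis
  proof cases
    case 1
    show ?thesis
    proof (cases "generic m i")
      case True
      have "generic m (- i)"
        using True dvd_minus_iff [of m "i - 1"] dvd_minus_iff [of m "i + 1"]
        by (auto simp: generic_def)
      with True 1 show ?thesis by (intro layer_centred [of i]) (auto simp: centred_def)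
    next
      case False
      then show ?thesis
        using 1 layer_centred [of 0] layer_centred [of 1] layer_centred [of "- 1"]
        by (auto simp: generic_def centred_def)
    qed
  next
    case 2
    show ?thesis
    proof (cases "generic m i \<and> \<not> m dvd i - 2")
      case True
      have "generic m (1 - i)"
        using True dvd_minus_iff [of m "i - 1"] dvd_minus_iff [of m "i - 2"]
        by (auto simp: generic_def)
      with True 2 show ?thesis by (intro layer_centred [of i]) (auto simp: centred_def)
    next
      case False
      then show ?thesis
        using 2 two layer_centred [of 0] layer_centred [of 1] layer_centred [of "- 1"] layer_centred [of 2]
        by (auto simp: generic_def centred_def)
    qed
  next
    case 3
    show ?thesis
    proof (cases "generic m i \<and> \<not> m dvd i + 2")
      case True
      have "generic m (- 1 - i)"
        using True
        by (auto simp: generic_def dvd_diff_commute [of m "- 1" i] dvd_diff_commute [of m "- 2" i])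
      with True 3 show ?thesis by (intro layer_centred [of i]) (auto simp: centred_def)
    next
      case False
      then show ?thesis
        using 3 two layer_centred [of 0] layer_centred [of 1] layer_centred [of "- 1"] layer_centred [of "- 2"]
        by (auto simp: generic_def centred_def)
    qed
  next
    case 4
    have "\<not> 3 dvd k - 1" "\<not> 3 dvd k + 1" "\<not> 3 dvd k - 2" "\<not> 3 dvd k + 2"
      using 4(2) by presburger+
    then have *: "\<not> m dvd k - 1" "\<not> m dvd k + 1" "\<not> m dvd k - 2" "\<not> m dvd k + 2"
      using dvd_trans [OF class_three_dvd] by blast+
    then have gk: "generic m (k - 1)" "generic m (k + 1)"
      using 4(1) by (simp_all add: generic_def add.commute [of 2])
    show ?thesis
    proof (cases "generic m i \<and> generic m (k - i)")
      case True
      with 4 show ?thesis by (intro layer_centred [of i]) (auto simp: centred_def)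
    next
      case False
      then consider "m dvd i" | "m dvd i - 1" | "m dvd i + 1" | "m dvd k - i" | "m dvd k - i - 1" | "m dvd k - i + 1"
        by (auto simp: generic_def)
      then show ?thesis
      proof cases
        case 1
        then show ?thesis using 4 by (intro layer_centred [of 0]) (auto simp: centred_def)
      next
        case 2
        then show ?thesis using gk by (intro layer_centred [of 1]) (auto simp: centred_def)
      next
        case 3
        then show ?thesis using gk by (intro layer_centred [of "- 1"]) (auto simp: centred_def)
      next
        case c: 4
        then show ?thesis using 4 by (intro layer_centred [of k]) (auto simp: centred_def dvd_diff_commute)
      next
        case 5
        then have "m dvd i - (k - 1)" using dvd_minus_iff [of m "k - i - 1"] by (simp add: algebra_simps)
        then show ?thesis using gk by (intro layer_centred [of "k - 1"]) (auto simp: centred_def)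
      next
        case 6
        then have "m dvd i - (k + 1)" using dvd_minus_iff [of m "k - i + 1"] by (simp add: algebra_simps)
        then show ?thesis using gk by (intro layer_centred [of "k + 1"]) (auto simp: centred_def)
      qed
    qed
  qed
qed

end

lemma class_fun_sum_layer:
  assumes "9 dvd m" "0 < m" "class_fun m \<phi>" "class_fun m \<psi>"
  shows "class_fun m (\<lambda>k y. \<Sum>i\<in>{0..<m}. layer m \<phi> \<psi> i k y)"
  unfolding class_fun_def
proof (intro conjI allI impI)
  show "periodic m (\<lambda>k y. \<Sum>i\<in>{0..<m}. layer m \<phi> \<psi> i k y)"
    using class_layer_periodic [OF assms] unfolding periodic_def by (metis (no_types, lifting) sum.cong)
  show "reflect_inv m (\<lambda>k y. \<Sum>i\<in>{0..<m}. layer m \<phi> \<psi> i k y) k" if "centred m k" for k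
    using layer_reflect_centred [OF assms that] unfolding reflect_inv_def
    by (intro allI sum.cong refl) blast
  show "shift_inv m (\<lambda>k y. \<Sum>i\<in>{0..<m}. layer m \<phi> \<psi> i k y) k p q" if "slope m k p q" for k p q
    using layer_slope [OF assms that] unfolding shift_inv_def
    by (intro allI sum.cong refl) blast
qed

text \<open>Writing \<open>l = i + m * x\<close> groups the convolution of \<open>gr_mult_E\<close>
  by cosets of \<open>H\<close>.\<close>

lemma sum_layer:
  assumes m: "0 < m" and m3: "3 dvd m" and per: "periodic m \<psi>"
  shows "(\<Sum>i\<in>{0..<m}. layer m \<phi> \<psi> i k y)
    = (\<Sum>l\<in>{0..<3 * m}. \<Sum>z\<in>{0..<3}. \<phi> l z * \<psi> (k - l + m * z * (k - l)) (y - z))"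
proof -
  let ?g = "\<lambda>l. \<Sum>z\<in>{0..<3}. \<phi> l z * \<psi> (k - l + m * z * (k - l)) (y - z)"
  have "(\<Sum>l\<in>{0..<3 * m}. ?g l) = (\<Sum>(i, x)\<in>{0..<m} \<times> {0..<3}. ?g (i + m * x))"
  proof (rule sum.reindex_bij_witness [where i = "\<lambda>(i, x). i + m * x" and j = "\<lambda>l. (l mod m, l div m)"])
    fix l assume l: "l \<in> {0..<3 * m}"
    have "m * (l div m) + l mod m < m * 3" "0 \<le> l mod m" using l m by simp_all
    then have "m * (l div m) < m * 3" by linarith
    then have "l div m < 3" using m by simp
    then show "(l mod m, l div m) \<in> {0..<m} \<times> {0..<3}"
      using l m by (simp add: pos_imp_zdiv_nonneg_iff)
  next
    fix p :: "int \<times> int" assume p: "p \<in> {0..<m} \<times> {0..<3}"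
    then have "m * snd p \<le> m * 2" "0 \<le> m * snd p" using m by auto
    moreover have "0 \<le> fst p" "fst p < m" using p by auto
    ultimately have "0 \<le> fst p + m * snd p" "fst p + m * snd p < 3 * m" by linarith+
    then show "(case p of (i, x) \<Rightarrow> i + m * x) \<in> {0..<3 * m}"
      by (simp add: case_prod_unfold)
    show "((case p of (i, x) \<Rightarrow> i + m * x) mod m, (case p of (i, x) \<Rightarrow> i + m * x) div m) = p"
      using p m by auto
  qed auto
  also have "\<dots> = (\<Sum>i\<in>{0..<m}. layer m \<phi> \<psi> i k y)"
    unfolding layer_def sum.cartesian_product [symmetric]
  proof (intro sum.cong refl arg_cong2 [where f = "(*)"] periodicD [OF per])
    fix i x z :: int
    have "3 * m dvd m * m * (z * x)" using m3 by (intro dvd_mult2 mult_dvd_mono) auto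
    then show "3 * m dvd k - (i + m * x) + m * z * (k - (i + m * x)) - (k - i - m * x + m * z * (k - i))"
      using dvd_minus_iff [of "3 * m" "m * m * (z * x)"] by (simp add: algebra_simps)
  qed simp
  finally show ?thesis by simp
qed

lemma class_fun_inverse:
  assumes m3: "3 dvd m" and cls: "class_fun m \<phi>"
  shows "class_fun m (\<lambda>k y. \<phi> (- k - m * k * y) (- y))"
proof -
  have per: "periodic m \<phi>" and refl: "\<And>k x y. centred m k \<Longrightarrow> \<phi> (k + m * x) y = \<phi> (k - m * x) (- y)"
    and sh: "\<And>k p q. slope m k p q \<Longrightarrow> shift_inv m \<phi> k p q"
    using cls by (simp_all add: class_fun_def reflect_inv_def)
  have neg: "m dvd - k - 1 \<longleftrightarrow> m dvd k + 1" "m dvd - k + 1 \<longleftrightarrow> m dvd k - 1" for k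
    using dvd_minus_iff [of m "k + 1"] dvd_minus_iff [of m "k - 1"] by simp_all
  have gen: "generic m (- k) \<longleftrightarrow> generic m k" for k
    using neg by (auto simp: generic_def)
  have mm: "3 * m dvd m * m * t" for t using m3 by (intro dvd_mult2 mult_dvd_mono) auto
  show ?thesis
    unfolding class_fun_def
  proof (intro conjI allI impI)
    show "periodic m (\<lambda>k y. \<phi> (- k - m * k * y) (- y))"
      unfolding periodic_def
    proof (intro allI impI periodicD [OF per])
      fix k l y z assume kl: "3 * m dvd k - l" and yz: "3 dvd y - (z :: int)"
      have "3 * m dvd (k - l) * (1 + m * y)" "3 * m dvd (y - z) * m * l"
        using kl yz by (intro dvd_mult2 mult_dvd_mono; simp)+
      from dvd_add [OF this] have "3 * m dvd - ((- k - m * k * y) - (- l - m * l * z))"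
        by (simp add: algebra_simps)
      then show "3 * m dvd (- k - m * k * y) - (- l - m * l * z)" by (simp only: dvd_minus_iff)
      show "3 dvd - y - - z" using yz by presburger
    qed
  next
    fix k assume k: "centred m k"
    then have nk: "centred m (- k)" by (auto simp: centred_def gen)
    show "reflect_inv m (\<lambda>k y. \<phi> (- k - m * k * y) (- y)) k"
      unfolding reflect_inv_def
    proof (intro allI)
      fix x y
      have "\<phi> (- (k + m * x) - m * (k + m * x) * y) (- y) = \<phi> (- k + m * (- x - k * y)) (- y)"
        using mm [of "- (x * y)"] by (intro periodicD [OF per]) (simp_all add: algebra_simps)
      also have "\<dots> = \<phi> (- k - m * (- x - k * y)) (- (- y))" by (rule refl [OF nk])
      also have "\<dots> = \<phi> (- (k - m * x) - m * (k - m * x) * (- y)) (- (- y))"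
        using mm [of "x * y"] by (intro periodicD [OF per]) (simp_all add: algebra_simps)
      finally show "\<phi> (- (k + m * x) - m * (k + m * x) * y) (- y)
        = \<phi> (- (k - m * x) - m * (k - m * x) * (- y)) (- (- y))" .
    qed
  next
    fix k p q assume sl: "slope m k p q"
    \<comment> \<open>Inversion takes the vector \<open>(p, q)\<close> at \<open>k\<close> to
      \<open>(- p - k * q, - q)\<close> at \<open>- k\<close>. It therefore exchanges the directions
      \<open>(0, 1)\<close> at 1 and \<open>(1, 1)\<close> at \<open>- 1\<close>, up to sign and
      modulo 3.\<close>
    have dual: "shift_inv m \<phi> (- k) (- p - k * q) (- q)"
    proof -
      consider (1) "generic m k" "p = 1" "q = 0" | (2) "m dvd k - 1" "p = 0" "q = 1"
        | (3) "m dvd k + 1" "p = 1" "q = 1" | (4) "generic m k" "\<not> 3 dvd k" "p = 0" "q = 1"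
        using sl by (auto simp: slope_def)
      then show ?thesis
      proof cases
        case 1
        then have "slope m (- k) 1 0" by (simp add: slope_def gen)
        from shift_inv_neg [OF sh [OF this]] 1 show ?thesis by simp
      next
        case 2
        then have "slope m (- k) 1 1" by (simp only: slope_def neg) simp
        from shift_inv_cong [OF per shift_inv_neg [OF sh [OF this]]]
        show ?thesis using 2 dvd_trans [OF m3 2(1)] by simp
      next
        case 3
        then have "slope m (- k) 0 1" by (simp only: slope_def neg) simp
        from shift_inv_neg [OF sh [OF this]] show ?thesis
          by (rule shift_inv_cong [OF per])
            (use 3 dvd_trans [OF m3 3(1)] in \<open>simp_all add: add.commute\<close>)
      next
        case 4
        then have "slope m (- k) 1 0" "slope m (- k) 0 1" by (simp_all add: slope_def gen)
        then show ?thesis by (rule shift_inv_full [OF sh sh])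
      qed
    qed
    show "shift_inv m (\<lambda>k y. \<phi> (- k - m * k * y) (- y)) k p q"
      unfolding shift_inv_def
    proof (intro allI)
      fix x y
      have "\<phi> (- (k + m * (x + p)) - m * (k + m * (x + p)) * (y + q)) (- (y + q))
        = \<phi> (- k + m * ((- x - k * y) + (- p - k * q))) (- y + - q)"
        using mm [of "- ((x + p) * (y + q))"] by (intro periodicD [OF per]) (simp_all add: algebra_simps)
      also have "\<dots> = \<phi> (- k + m * (- x - k * y)) (- y)"
        using dual by (simp only: shift_inv_def)
      also have "\<dots> = \<phi> (- (k + m * x) - m * (k + m * x) * y) (- y)"
        using mm [of "x * y"] by (intro periodicD [OF per]) (simp_all add: algebra_simps)
      finally show "\<phi> (- (k + m * (x + p)) - m * (k + m * (x + p)) * (y + q)) (- (y + q))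
        = \<phi> (- (k + m * x) - m * (k + m * x) * y) (- y)" .
    qed
  qed
qed

section \<open>The S-ring for order at least 81\<close>

context modular_3_group
begin

text \<open>The conditions of \<open>class_fun\<close> as pairs of group elements; periodicity is
  automatic for functions of \<open>E k y\<close>.\<close>

definition class_moves :: "('a \<times> 'a) set" where
  "class_moves = {(E (k + m * x) y, E (k - m * x) (- y)) | k x y. centred m k} \<union>
     {(E (k + m * (x + p)) (y + q), E (k + m * x) y) | k x y p q. slope m k p q}"

lemma class_moves_E:
  assumes "(u, v) \<in> class_moves"
  obtains (reflect) k x y where "u = E (k + m * x) y" "v = E (k - m * x) (- y)" "centred m k"
  | (shift) k x y p q where "u = E (k + m * (x + p)) (y + q)" "v = E (k + m * x) y" "slope m k p q"
  using assms unfolding class_moves_def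
proof (elim UnE CollectE exE conjE)
  fix k x y assume "(u, v) = (E (k + m * x) y, E (k - m * x) (- y))" "centred m k"
  then show thesis by (intro reflect [of k x y]) simp_all
next
  fix k x y p q assume "(u, v) = (E (k + m * (x + p)) (y + q), E (k + m * x) y)" "slope m k p q"
  then show thesis by (intro shift [of k x p y q]) simp_all
qed

lemma class_moves_closed: "class_moves \<subseteq> carrier G \<times> carrier G"
  by (auto simp: class_moves_def)

abbreviation class_ring :: "('a \<Rightarrow> int) set" where
  "class_ring \<equiv> move_ring G class_moves"

lemma class_fun_class_ring:
  assumes f: "f \<in> class_ring"
  shows "class_fun m (\<lambda>k y. f (E k y))"
proof -
  have eq: "f u = f v" if "(u, v) \<in> class_moves" for u v
    using f that by (auto simp: move_ring_def)
  show ?thesis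
    unfolding class_fun_def periodic_def reflect_inv_def shift_inv_def
  proof (intro conjI allI impI)
    fix k l y z assume "3 * m dvd k - l" "3 dvd y - (z :: int)"
    then show "f (E k y) = f (E l z)" using E_cong by simp
  next
    fix k x y assume "centred m k"
    then show "f (E (k + m * x) y) = f (E (k - m * x) (- y))"
      by (intro eq) (unfold class_moves_def, blast)
  next
    fix k p q x y assume "slope m k p q"
    then show "f (E (k + m * (x + p)) (y + q)) = f (E (k + m * x) y)"
      by (intro eq) (unfold class_moves_def, blast)
  qed
qed

lemma eq_on_class_moves:
  assumes cls: "class_fun m (\<lambda>k y. f (E k y))" and uv: "(u, v) \<in> class_moves"
  shows "f u = f v"
  using uv
proof (cases rule: class_moves_E)
  case (reflect k x y)
  with cls show ?thesis by (simp add: class_fun_def reflect_inv_def)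
next
  case (shift k x y p q)
  then have "shift_inv m (\<lambda>k y. f (E k y)) k p q" using cls unfolding class_fun_def by blast
  with shift(1,2) show ?thesis by (simp only: shift_inv_def)
qed

lemma mem_class_moves_iff:
  assumes refl: "\<And>k x y. centred m k \<Longrightarrow> E (k + m * x) y \<in> X \<longleftrightarrow> E (k - m * x) (- y) \<in> X"
    and shift: "\<And>k x y p q. slope m k p q \<Longrightarrow> E (k + m * (x + p)) (y + q) \<in> X \<longleftrightarrow> E (k + m * x) y \<in> X"
    and uv: "(u, v) \<in> class_moves"
  shows "u \<in> X \<longleftrightarrow> v \<in> X"
  using uv by (cases rule: class_moves_E) (simp_all only: refl shift)

section \<open>The S-ring for \<open>9 dvd m\<close> and some of its sets\<close>

context
  assumes nine: "9 dvd m"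
begin

lemma m_small: "\<not> m dvd 1" "\<not> m dvd 2"
proof -
  have "9 \<le> m" using nine m_pos by (rule zdvd_imp_le)
  then show "\<not> m dvd 1" "\<not> m dvd 2" using zdvd_imp_le [of m 1] zdvd_imp_le [of m 2] by auto
qed

lemma centred_dvd: "centred m k \<Longrightarrow> m dvd k \<longleftrightarrow> k = 0"
  using m_small by (auto simp: centred_def generic_def)

lemma centred_dvd1: "centred m k \<Longrightarrow> m dvd k - 1 \<longleftrightarrow> k = 1"
  using m_small by (auto simp: centred_def generic_def)

lemma slope_not_dvd: "slope m k p q \<Longrightarrow> \<not> m dvd k"
proof
  assume sl: "slope m k p q" and k: "m dvd k"
  have "\<not> m dvd k - 1" "\<not> m dvd k + 1"
    using m_small dvd_diff [OF k, of "k - 1"] dvd_diff [OF _ k, of "k + 1"] by auto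
  with sl k show False by (auto simp: slope_def generic_def)
qed

lemma slope_dvd1: "slope m k p q \<Longrightarrow> m dvd k - 1 \<Longrightarrow> p = 0"
proof -
  assume sl: "slope m k p q" and k: "m dvd k - 1"
  have "\<not> m dvd k + 1" using m_small dvd_diff [OF _ k, of "k + 1"] by auto
  with sl k show "p = 0" by (auto simp: slope_def generic_def)
qed

lemma slope_dvd3: "slope m k p q \<Longrightarrow> 3 dvd k \<Longrightarrow> q = 0"
proof -
  assume sl: "slope m k p q" and k: "3 dvd k"
  have "\<not> 3 dvd k - 1" "\<not> 3 dvd k + 1" using k by presburger+
  then have "\<not> m dvd k - 1" "\<not> m dvd k + 1" using dvd_trans [OF three_dvd_m] by blast+
  with sl k show "q = 0" by (auto simp: slope_def)
qed

lemma dvd_mod_m: "3 * m dvd k + m * x - l \<Longrightarrow> m dvd k - l"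
proof -
  assume "3 * m dvd k + m * x - l"
  then have "m dvd k + m * x - l" by (rule dvd_mult_right)
  from dvd_diff [OF this dvd_triv_left [of m x]] show ?thesis by simp
qed

lemma three_m_dvd: "3 * m dvd m * x \<longleftrightarrow> 3 dvd x"
  using m_pos by (simp add: mult.commute [of 3 m])

lemma dvd_base: "m dvd k + m * x - l \<longleftrightarrow> m dvd k - l"
proof -
  have "k + m * x - l = (k - l) + m * x" by simp
  then show ?thesis by (simp only: dvd_add_times_triv_right_iff mult.commute [of m x])
qed

lemma is_S_ring_class_ring: "is_S_ring G class_ring"
proof (rule is_S_ring_move_ring [OF finite_carrier class_moves_closed])
  fix u v assume uv: "(u, v) \<in> class_moves"
  have one: "E k y \<in> {\<one>} \<longleftrightarrow> 3 * m dvd k \<and> 3 dvd y" for k y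
    by (simp add: E_0_0 [symmetric] E_eq_iff)
  have "u \<in> {\<one>} \<longleftrightarrow> v \<in> {\<one>}"
  proof (rule mem_class_moves_iff [OF _ _ uv]; unfold one)
    fix k x y :: int assume "centred m k"
    then show "3 * m dvd k + m * x \<and> 3 dvd y \<longleftrightarrow> 3 * m dvd k - m * x \<and> 3 dvd - y"
      using dvd_mod_m [of k x 0] dvd_mod_m [of k "- x" 0] by (auto simp: centred_dvd three_m_dvd)
  next
    fix k x y p q :: int assume "slope m k p q"
    then show "3 * m dvd k + m * (x + p) \<and> 3 dvd y + q \<longleftrightarrow> 3 * m dvd k + m * x \<and> 3 dvd y"
      using dvd_mod_m [of k "x + p" 0] dvd_mod_m [of k x 0] slope_not_dvd by auto
  qed
  then show "u = \<one> \<longleftrightarrow> v = \<one>" by simp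
  fix f assume f: "f \<in> class_ring"
  have "class_fun m (\<lambda>k y. f (inv (E k y)))"
    using class_fun_inverse [OF three_dvd_m class_fun_class_ring [OF f]] by (simp add: E_inv)
  then show "f (inv u) = f (inv v)"
    using eq_on_class_moves [OF _ uv, of "\<lambda>x. f (inv x)"] by simp
  fix g assume g: "g \<in> class_ring"
  note fg = class_fun_class_ring [OF f] class_fun_class_ring [OF g]
  have "class_fun m (\<lambda>k y. gr_mult G f g (E k y))"
    using class_fun_sum_layer [OF nine m_pos fg] fg(2)
    by (simp add: gr_mult_E sum_layer [OF m_pos three_dvd_m] class_fun_def)
  then show "gr_mult G f g u = gr_mult G f g v" by (rule eq_on_class_moves) (rule uv)
qed

text \<open>No shift acts on \<open>H\<close>, and 0 is the only centred representative of
  \<open>H\<close>, so moves inside \<open>H\<close> only exchange an element and its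
  inverse.\<close>

lemma ul_inverse_pair: "ul {E (m * u) v, E (- m * u) (- v)} \<in> class_ring"
proof -
  define X where "X = {E (m * u) v, E (- m * u) (- v)}"
  have mem: "E k y \<in> X \<longleftrightarrow> (3 * m dvd k - m * u \<and> 3 dvd y - v) \<or> (3 * m dvd k + m * u \<and> 3 dvd y + v)" for k y
    by (simp add: X_def E_eq_iff)
  have iff: "s \<in> X \<longleftrightarrow> t \<in> X" if st: "(s, t) \<in> class_moves" for s t
  proof (rule mem_class_moves_iff [OF _ _ st]; unfold mem)
    fix k x y assume k: "centred m k"
    have a: "3 dvd - y - v \<longleftrightarrow> 3 dvd y + v" "3 dvd - y + v \<longleftrightarrow> 3 dvd y - v" by presburger+
    have b: "3 * m dvd k + m * x \<longleftrightarrow> k = 0 \<and> 3 dvd x" for x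
    proof (cases "k = 0")
      case False
      then show ?thesis using dvd_mod_m [of k x 0] centred_dvd [OF k] by auto
    qed (simp add: three_m_dvd)
    have c: "3 dvd - x - u \<longleftrightarrow> 3 dvd x + u" "3 dvd - x + u \<longleftrightarrow> 3 dvd x - u" by presburger+
    have d: "3 * m dvd k + m * x - m * u \<longleftrightarrow> k = 0 \<and> 3 dvd x - u"
      "3 * m dvd k + m * x + m * u \<longleftrightarrow> k = 0 \<and> 3 dvd x + u"
      "3 * m dvd k - m * x - m * u \<longleftrightarrow> k = 0 \<and> 3 dvd x + u"
      "3 * m dvd k - m * x + m * u \<longleftrightarrow> k = 0 \<and> 3 dvd x - u"
    proof -
      have e: "k + m * x - m * u = k + m * (x - u)" "k + m * x + m * u = k + m * (x + u)"
        "k - m * x - m * u = k + m * (- x - u)" "k - m * x + m * u = k + m * (- x + u)"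
        by (simp_all add: right_diff_distrib distrib_left)
      show "3 * m dvd k + m * x - m * u \<longleftrightarrow> k = 0 \<and> 3 dvd x - u"
        "3 * m dvd k + m * x + m * u \<longleftrightarrow> k = 0 \<and> 3 dvd x + u"
        "3 * m dvd k - m * x - m * u \<longleftrightarrow> k = 0 \<and> 3 dvd x + u"
        "3 * m dvd k - m * x + m * u \<longleftrightarrow> k = 0 \<and> 3 dvd x - u"
        by (simp_all only: e b c)
    qed
    show "(3 * m dvd k + m * x - m * u \<and> 3 dvd y - v) \<or> (3 * m dvd k + m * x + m * u \<and> 3 dvd y + v) \<longleftrightarrow>
        (3 * m dvd k - m * x - m * u \<and> 3 dvd - y - v) \<or> (3 * m dvd k - m * x + m * u \<and> 3 dvd - y + v)"
      unfolding d a by blast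
  next
    fix k x y p q assume "slope m k p q"
    then have "\<not> 3 * m dvd k + m * x" for x
      using dvd_mod_m [of k x 0] slope_not_dvd by auto
    from this [of "_ - u"] this [of "_ + u"]
    have n: "\<not> 3 * m dvd k + m * x - m * u" "\<not> 3 * m dvd k + m * x + m * u" for x
      by (simp_all only: right_diff_distrib distrib_left add_diff_eq add.assoc not_False_eq_True)
    show "(3 * m dvd k + m * (x + p) - m * u \<and> 3 dvd y + q - v) \<or> (3 * m dvd k + m * (x + p) + m * u \<and> 3 dvd y + q + v) \<longleftrightarrow>
        (3 * m dvd k + m * x - m * u \<and> 3 dvd y - v) \<or> (3 * m dvd k + m * x + m * u \<and> 3 dvd y + v)"
      by (simp only: n simp_thms)
  qed
  have "X \<subseteq> carrier G" by (simp add: X_def)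
  then have "ul X \<in> class_ring" using iff by (rule ul_mem_move_ring)
  then show ?thesis by (simp only: X_def)
qed

text \<open>This is \<open>a B\<close>. The moves on \<open>a H\<close> are the shift by
  \<open>b\<close> and the reflection about \<open>a\<close>, and both preserve it.\<close>

lemma ul_coset_b: "ul (range (E 1)) \<in> class_ring"
proof (rule ul_mem_move_ring)
  have mem: "E k y \<in> range (E 1) \<longleftrightarrow> 3 * m dvd k - 1" for k y
  proof
    assume "E k y \<in> range (E 1)"
    then show "3 * m dvd k - 1" by (auto simp: E_eq_iff)
  next
    assume "3 * m dvd k - 1"
    then have "E k y = E 1 y" by (simp add: E_eq_iff)
    then show "E k y \<in> range (E 1)" by simp
  qed
  fix s t assume st: "(s, t) \<in> class_moves"
  show "s \<in> range (E 1) \<longleftrightarrow> t \<in> range (E 1)"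
  proof (rule mem_class_moves_iff [OF _ _ st]; unfold mem)
    fix k x assume k: "centred m k"
    show "3 * m dvd k + m * x - 1 \<longleftrightarrow> 3 * m dvd k - m * x - 1"
    proof (cases "k = 1")
      case False
      then show ?thesis
        using dvd_mod_m [of k x 1] dvd_mod_m [of k "- x" 1] centred_dvd1 [OF k] by auto
    qed simp
  next
    fix k x p q assume sl: "slope m k p q"
    show "3 * m dvd k + m * (x + p) - 1 \<longleftrightarrow> 3 * m dvd k + m * x - 1"
    proof (cases "m dvd k - 1")
      case True
      then show ?thesis using slope_dvd1 [OF sl] by simp
    next
      case False
      then show ?thesis using dvd_mod_m [of k "x + p" 1] dvd_mod_m [of k x 1] by blast
    qed
  qed
qed auto

text \<open>This is the coset \<open>a^j C\<close>. Shifts over exponents divisible by 3 have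
  \<open>q = 0\<close>, and reflections only negate \<open>y\<close>.\<close>

lemma ul_coset_c:
  assumes j: "3 dvd j"
  shows "ul (range (\<lambda>s. E (j + m * s) 0)) \<in> class_ring"
proof (rule ul_mem_move_ring)
  let ?X = "range (\<lambda>s. E (j + m * s) 0)"
  have mem: "E k y \<in> ?X \<longleftrightarrow> m dvd k - j \<and> 3 dvd y" for k y
  proof
    assume "E k y \<in> ?X"
    then obtain s where s: "3 * m dvd k - (j + m * s)" "3 dvd y" by (auto simp: E_eq_iff)
    have "k - (j + m * s) = k + m * (- s) - j" by simp
    with s show "m dvd k - j \<and> 3 dvd y" using dvd_mod_m [of k "- s" j] by metis
  next
    assume R: "m dvd k - j \<and> 3 dvd y"
    then obtain s where "k - j = m * s" by (metis dvdE)
    then have "k - (j + m * s) = 0" by simp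
    with R have "E k y = E (j + m * s) 0" by (intro E_cong) simp_all
    then show "E k y \<in> ?X" by simp
  qed
  fix s t assume st: "(s, t) \<in> class_moves"
  show "s \<in> ?X \<longleftrightarrow> t \<in> ?X"
  proof (rule mem_class_moves_iff [OF _ _ st]; unfold mem)
    fix k x y :: int
    show "m dvd k + m * x - j \<and> 3 dvd y \<longleftrightarrow> m dvd k - m * x - j \<and> 3 dvd - y"
      using dvd_base [of k "- x" j] by (simp add: dvd_base)
  next
    fix k x y p q assume sl: "slope m k p q"
    have "q = 0" if "m dvd k - j"
    proof -
      have "3 dvd (k - j) + j" using dvd_trans [OF three_dvd_m that] j by (rule dvd_add)
      then show ?thesis using slope_dvd3 [OF sl] by simp
    qed
    then show "m dvd k + m * (x + p) - j \<and> 3 dvd y + q \<longleftrightarrow> m dvd k + m * x - j \<and> 3 dvd y"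
      unfolding dvd_base by (cases "m dvd k - j") simp_all
  qed
qed auto

end

end

section \<open>Fixed points of colour preserving permutations\<close>

text \<open>By induction the square of \<open>\<delta>\<close> fixes some \<open>x\<close>. If
  \<open>\<delta>\<close> moves \<open>x\<close>, it swaps two points and fixes the third.\<close>

lemma triple_fixpoint:
  assumes "card L = 3" "inj_on \<delta> L" "\<delta> ` L \<subseteq> L" "\<And>x. x \<in> L \<Longrightarrow> (\<delta> ^^ (2 ^ s)) x = x"
  shows "\<exists>x\<in>L. \<delta> x = x"
  using assms
proof (induction s arbitrary: \<delta>)
  case 0
  then have "L \<noteq> {}" by auto
  then obtain x where "x \<in> L" by blast
  with 0(4) [of x] show ?case by auto
next
  case (Suc s)
  have "\<exists>x\<in>L. (\<delta> ^^ 2) x = x"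
  proof (rule Suc.IH)
    show "inj_on (\<delta> ^^ 2) L"
      using Suc.prems(2,3) by (auto simp: numeral_2_eq_2 inj_on_def image_subset_iff)
    show "(\<delta> ^^ 2) ` L \<subseteq> L" using Suc.prems(3) by (auto simp: numeral_2_eq_2)
    show "((\<delta> ^^ 2) ^^ (2 ^ s)) x = x" if "x \<in> L" for x
      using Suc.prems(4) [OF that] by (simp add: funpow_mult)
  qed (rule Suc.prems)
  then obtain x where x: "x \<in> L" "\<delta> (\<delta> x) = x" by (auto simp: numeral_2_eq_2)
  show ?case
  proof (cases "\<delta> x = x")
    case False
    have y: "\<delta> x \<in> L" using x Suc.prems(3) by blast
    have "card (L - {x, \<delta> x}) = 1"
      using x y False Suc.prems(1) by (subst card_Diff_subset) auto
    then obtain z where "L - {x, \<delta> x} = {z}" by (auto simp: card_1_singleton_iff)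
    then have z: "z \<in> L" "z \<noteq> x" "z \<noteq> \<delta> x" and L: "\<And>w. w \<in> L \<Longrightarrow> w = x \<or> w = \<delta> x \<or> w = z"
      by auto
    have "\<delta> z \<in> L" using z Suc.prems(3) by blast
    moreover have "\<delta> z \<noteq> \<delta> x" using z x inj_onD [OF Suc.prems(2)] by metis
    moreover have "\<delta> z \<noteq> x" using z x y inj_onD [OF Suc.prems(2), of z "\<delta> x"] by metis
    ultimately show ?thesis using L z by metis
  qed (use x in blast)
qed

lemma odd_decomposition: "(n :: nat) > 0 \<Longrightarrow> \<exists>s r. odd r \<and> n = r * 2 ^ s"
proof (induction n rule: less_induct)
  case (less n)
  show ?case
  proof (cases "odd n")
    case True
    then show ?thesis by (intro exI [of _ 0] exI [of _ n]) simp
  next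
    case False
    then obtain k where k: "n = 2 * k" by blast
    with less.prems less.IH [of k] obtain s r where "odd r" "k = r * 2 ^ s" by auto
    with k show ?thesis by (intro exI [of _ "Suc s"] exI [of _ r]) simp
  qed
qed

text \<open>If the order divides \<open>r * 2 ^ s\<close> with \<open>r\<close> odd, the power with
  exponent \<open>r\<close> has order dividing \<open>2 ^ s\<close>.\<close>

lemma bij_betw_two_power_part:
  assumes "finite C" "bij_betw \<gamma> C C"
  obtains r s where "odd r" "\<And>x. x \<in> C \<Longrightarrow> ((\<gamma> ^^ r) ^^ (2 ^ s)) x = x"
proof -
  \<comment> \<open>Extending by the identity outside \<open>C\<close> gives a permutation of the
    whole type, whose nilpotency can be used.\<close>
  define p where "p x = (if x \<in> C then \<gamma> x else x)" for x
  have "bij_betw p C C" using assms(2) by (simp add: p_def cong: bij_betw_cong)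
  then have "p permutes C" by (rule bij_imp_permutes) (simp add: p_def)
  then have "permutation p" using assms(1) permutation_permutes by blast
  then obtain n where n: "p ^^ n = id" "n > 0" by (rule permutation_is_nilpotent)
  have "(\<gamma> ^^ i) x = (p ^^ i) x \<and> (p ^^ i) x \<in> C" if "x \<in> C" for x i
  proof (induction i)
    case (Suc i)
    then show ?case using bij_betwE [OF assms(2)] by (simp add: p_def)
  qed (use that in simp)
  then have id: "(\<gamma> ^^ n) x = x" if "x \<in> C" for x using that n(1) by simp
  obtain r s where "odd r" "n = r * 2 ^ s" using odd_decomposition [OF n(2)] by blast
  with id show thesis by (intro that [of r s]) (simp_all add: funpow_mult mult.commute)
qed

context modular_3_group
begin

lemma E_div_fibre:
  "E (k + m * X) Y \<otimes> inv (E (k + m * X') Y')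
    = E (m * ((X - X') + k * (Y - Y'))) (Y - Y')"
proof -
  have "k + m * X - (k + m * X') + m * (k + m * X') * (Y - Y') - m * ((X - X') + k * (Y - Y'))
      = m * m * (X' * (Y - Y'))" by (simp add: algebra_simps)
  then show ?thesis using dvd_msq [of "X' * (Y - Y')"] unfolding E_div by (intro E_cong) simp_all
qed

lemma cancel_three_m: "3 * m dvd (k + m * x) - (k + m * x') \<longleftrightarrow> 3 dvd x - x'"
proof -
  have "(k + m * x) - (k + m * x') = m * (x - x')" by (simp add: algebra_simps)
  then show ?thesis using m_pos by (simp add: mult.commute [of 3 m])
qed

section \<open>Existence and uniqueness of fixed points in the cosets of \<open>H\<close>\<close>

context
  fixes \<delta> :: "'a \<Rightarrow> 'a" and s :: nat
  assumes nine: "9 dvd m" and \<delta>: "col_preserving G class_ring \<delta>"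
    and two_power: "\<And>x. x \<in> carrier G \<Longrightarrow> (\<delta> ^^ (2 ^ s)) x = x"
    and moved: "\<delta> (E m 0) \<noteq> E m 0"
begin

definition fixed :: "int \<Rightarrow> int \<Rightarrow> bool" where
  "fixed k y \<longleftrightarrow> \<delta> (E k y) = E k y"

lemma fixed_cong: "fixed k y \<Longrightarrow> 3 * m dvd k - l \<Longrightarrow> 3 dvd y - z \<Longrightarrow> fixed l z"
  using E_cong [of k l y z] by (simp add: fixed_def)

lemma fixed_0: "fixed 0 0"
  using \<delta> by (simp add: fixed_def E_0_0 col_preserving_def)

text \<open>Since \<open>x\<close> is fixed and \<open>X\<close> is a union of basic sets,
  \<open>\<delta>\<close> permutes the three-element set \<open>X x\<close>.\<close>

lemma fixpoint_in_translate:
  assumes X: "ul X \<in> class_ring" "X \<subseteq> carrier G" "card X = 3"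
    and x: "x \<in> carrier G" "\<delta> x = x"
  obtains u where "u \<in> X" "\<delta> (u \<otimes> x) = u \<otimes> x"
proof -
  let ?L = "(\<lambda>u. u \<otimes> x) ` X"
  have L: "w \<in> ?L \<longleftrightarrow> w \<otimes> inv x \<in> X" if "w \<in> carrier G" for w
  proof
    assume "w \<otimes> inv x \<in> X"
    moreover have "w = (w \<otimes> inv x) \<otimes> x" using that x by (simp add: m_assoc)
    ultimately show "w \<in> ?L" by blast
  qed (use X(2) x in \<open>auto simp: m_assoc subset_iff\<close>)
  have LC: "?L \<subseteq> carrier G" using X(2) x by auto
  have "\<exists>w\<in>?L. \<delta> w = w"
  proof (rule triple_fixpoint)
    have "inj_on (\<lambda>u. u \<otimes> x) X" using X(2) x by (auto simp: inj_on_def subset_iff)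
    then show "card ?L = 3" using X(3) by (simp add: card_image)
    have "inj_on \<delta> (carrier G)" using \<delta> by (simp add: col_preserving_def bij_betw_def)
    then show "inj_on \<delta> ?L" using LC by (rule inj_on_subset)
    show "\<delta> ` ?L \<subseteq> ?L"
    proof
      fix v assume "v \<in> \<delta> ` ?L"
      then obtain w where w: "w \<in> ?L" "v = \<delta> w" by blast
      then have wC: "w \<in> carrier G" using LC by blast
      have "\<delta> w \<otimes> inv (\<delta> x) \<in> X"
        using col_preservingD [OF \<delta> X(1) x(1) wC] L [OF wC] w by simp
      then show "v \<in> ?L" using L [OF col_preserving_closed [OF \<delta> wC]] x w by simp
    qed
    show "(\<delta> ^^ (2 ^ s)) w = w" if "w \<in> ?L" for w using two_power LC that by blast
  qed
  then show thesis using that by blast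
qed

lemma fixed_next:
  assumes "fixed k z"
  obtains t where "fixed (1 + k - m * k * t) (t + z)"
proof -
  have "range (E 1) = E 1 ` {0, 1, 2}"
  proof (intro equalityI subsetI)
    fix w assume "w \<in> range (E 1)"
    then obtain t where "w = E 1 t" by blast
    then have "w = E 1 (t mod 3)" using E_cong [of 1 1 t "t mod 3"] by (simp add: dvd_minus_mod)
    then show "w \<in> E 1 ` {0, 1, 2}" using mod3_cases by blast
  qed auto
  then have card: "card (range (E 1)) = 3" by (simp add: E_eq_iff)
  have sub: "range (E 1) \<subseteq> carrier G" by auto
  obtain u where u: "u \<in> range (E 1)" "\<delta> (u \<otimes> E k z) = u \<otimes> E k z"
    using fixpoint_in_translate [OF ul_coset_b [OF nine] sub card E_closed assms [unfolded fixed_def]] .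
  then obtain t where "u = E 1 t" by blast
  with u have "fixed (1 + k - m * k * t) (t + z)" by (simp add: fixed_def E_mult)
  then show thesis by (rule that)
qed

lemma fixed_central:
  assumes "fixed k z" "3 dvd j"
  obtains t where "fixed (j + m * t + k) z"
proof -
  let ?X = "range (\<lambda>t. E (j + m * t) 0)"
  have "?X = (\<lambda>t. E (j + m * t) 0) ` {0, 1, 2}"
  proof (intro equalityI subsetI)
    fix w assume "w \<in> ?X"
    then obtain t where "w = E (j + m * t) 0" by blast
    then have "w = E (j + m * (t mod 3)) 0"
      using E_cong [of "j + m * t" "j + m * (t mod 3)" 0 0] by (simp only: cancel_three_m) (simp add: dvd_minus_mod)
    then show "w \<in> (\<lambda>t. E (j + m * t) 0) ` {0, 1, 2}" using mod3_cases by blast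
  qed blast
  moreover have "card ((\<lambda>t. E (j + m * t) 0) ` {0, 1, 2}) = 3"
    by (subst card_image) (use m_pos in \<open>auto simp: inj_on_def E_eq_iff cancel_three_m\<close>)
  ultimately have card: "card ?X = 3" by simp
  have sub: "?X \<subseteq> carrier G" by auto
  obtain u where u: "u \<in> ?X" "\<delta> (u \<otimes> E k z) = u \<otimes> E k z"
    using fixpoint_in_translate
      [OF ul_coset_c [OF nine assms(2)] sub card E_closed assms(1) [unfolded fixed_def]] .
  then obtain t where "u = E (j + m * t) 0" by blast
  with u have "fixed (j + m * t + k) z" by (simp add: fixed_def E_mult)
  then show thesis by (rule that)
qed

text \<open>The quotient \<open>h\<close> of the two points lies in \<open>H\<close>, so its image
  is \<open>h\<close> or \<open>h^-1\<close>; the second case is the point reflection about the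
  fixed point.\<close>

lemma reflect_about_fixed:
  assumes "fixed (k + m * x) y"
  shows "\<delta> (E (k + m * X) Y) = E (k + m * X) Y \<or>
    \<delta> (E (k + m * X) Y) = E (k + m * (2 * x - X)) (2 * y - Y)"
proof -
  let ?P = "E (k + m * x) y" and ?W = "E (k + m * X) Y"
  let ?u = "X - x + k * (Y - y)"
  let ?v = "Y - y"
  have W: "?W \<otimes> inv ?P = E (m * ?u) ?v" by (rule E_div_fibre)
  have "\<delta> ?W \<otimes> inv (\<delta> ?P) \<in> {E (m * ?u) ?v, E (- m * ?u) (- ?v)}"
    by (simp only: col_preservingD [OF \<delta> ul_inverse_pair [OF nine] E_closed E_closed] W) simp
  then have "\<delta> ?W \<otimes> inv ?P = E (m * ?u) ?v \<or> \<delta> ?W \<otimes> inv ?P = E (- m * ?u) (- ?v)"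
    using assms by (simp add: fixed_def)
  moreover have "\<delta> ?W = (\<delta> ?W \<otimes> inv ?P) \<otimes> ?P"
    using col_preserving_closed [OF \<delta> E_closed] by (simp add: m_assoc)
  moreover have "E (m * ?u) ?v \<otimes> ?P = ?W"
    unfolding W [symmetric] by (simp add: m_assoc)
  moreover have "E (- m * ?u) (- ?v) \<otimes> ?P = E (k + m * (2 * x - X)) (2 * y - Y)"
  proof -
    have "- m * ?u + (k + m * x) - m * (k + m * x) * (- ?v) - (k + m * (2 * x - X))
      = m * m * (x * ?v)" by (simp add: algebra_simps)
    then show ?thesis
      using dvd_msq [of "x * ?v"] unfolding E_mult by (intro E_cong) simp_all
  qed
  ultimately show ?thesis by metis
qed

definition whole :: "int \<Rightarrow> bool" where
  "whole k \<longleftrightarrow> (\<forall>x y. fixed (k + m * x) y)"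

text \<open>A moved point would have the same mirror image about both fixed points, which is
  impossible as 2 is invertible modulo 3.\<close>

lemma two_fixed:
  assumes P: "fixed (k + m * x) y" and Q: "fixed (k + m * x') y'"
    and neq: "\<not> (3 dvd x - x' \<and> 3 dvd y - y')"
  shows "whole k"
  unfolding whole_def
proof (intro allI)
  fix X Y
  show "fixed (k + m * X) Y"
  proof (rule ccontr)
    assume "\<not> fixed (k + m * X) Y"
    then have "E (k + m * (2 * x - X)) (2 * y - Y) = E (k + m * (2 * x' - X)) (2 * y' - Y)"
      using reflect_about_fixed [OF P, of X Y] reflect_about_fixed [OF Q, of X Y]
      by (simp add: fixed_def)
    then have "3 dvd (2 * x - X) - (2 * x' - X)" "3 dvd (2 * y - Y) - (2 * y' - Y)"
      by (simp_all only: E_eq_iff cancel_three_m)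
    with neq show False by presburger
  qed
qed

text \<open>The fixed points \<open>a^k\<close> and \<open>a^k c\<close> give fixed points in the
  disjoint sets \<open>a B a^k\<close> and \<open>a B a^k c\<close>, hence two different ones in the
  next coset.\<close>

lemma whole_Suc:
  assumes "whole k"
  shows "whole (1 + k)"
proof -
  have "fixed (k + m * 0) 0" "fixed (k + m * 1) 0" using assms unfolding whole_def by blast+
  then obtain t t' where t: "fixed (1 + (k + m * 0) - m * (k + m * 0) * t) (t + 0)"
    and t': "fixed (1 + (k + m * 1) - m * (k + m * 1) * t') (t' + 0)"
    by (metis fixed_next)
  have "fixed (1 + k + m * (- k * t)) t" using t by (simp add: algebra_simps)
  moreover have "fixed (1 + k + m * (1 - (k + m) * t')) t'" using t' by (simp add: algebra_simps)
  moreover have "\<not> (3 dvd - k * t - (1 - (k + m) * t') \<and> 3 dvd t - t')"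
  proof
    assume "3 dvd - k * t - (1 - (k + m) * t') \<and> 3 dvd t - t'"
    then have d: "3 dvd - k * t - (1 - (k + m) * t')" "3 dvd (t - t') * k" by simp_all
    from dvd_diff [OF dvd_add [OF d] dvd_mult2 [OF three_dvd_m, of t']]
    show False by (simp add: algebra_simps)
  qed
  ultimately show ?thesis by (rule two_fixed)
qed

lemma not_whole: "\<not> whole k"
proof
  assume k: "whole k"
  have step: "whole (int i + k)" for i :: nat
  proof (induction i)
    case (Suc i)
    from whole_Suc [OF this] show ?case by (simp add: add.assoc [symmetric])
  qed (simp add: k)
  \<comment> \<open>Enough steps to bring the exponent of \<open>a\<close> back to 0 modulo
    \<open>3 * m\<close>, so that \<open>c\<close> itself would be fixed.\<close>
  let ?i = "nat ((- k) mod (3 * m))"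
  have "int ?i = (- k) mod (3 * m)" using m_pos by simp
  then have "3 * m dvd int ?i + k" by (metis dvd_minus_mod dvd_minus_iff minus_diff_eq diff_minus_eq_add)
  moreover have "fixed (int ?i + k + m * 1) 0" using step [of ?i] unfolding whole_def by blast
  ultimately have "fixed m 0" by (elim fixed_cong) simp_all
  with moved show False by (simp add: fixed_def)
qed

lemma fixed_unique:
  "fixed (k + m * x) y \<Longrightarrow> fixed (k + m * x') y' \<Longrightarrow> 3 dvd x - x' \<and> 3 dvd y - y'"
  using two_fixed not_whole by blast

text \<open>
  Fixed points \<open>p\<^sub>1 \<in> a B\<close>, \<open>p\<^sub>2 \<in> a B p\<^sub>1\<close>, \<open>p\<^sub>3 \<in> a B p\<^sub>2\<close> exist, and by uniqueness in its coset
  \<open>p\<^sub>3 = a\<^sup>3 c\<^sup>g\<close> is central; for a central fixed point \<open>z\<close> uniqueness then forces \<open>p\<^sub>1 z\<close>, \<open>p\<^sub>2 z\<close>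
  and \<open>p\<^sub>3 z\<close> to be fixed as well.
\<close>

lemma fixed_step:
  obtains g where "\<And>K. 3 dvd K \<Longrightarrow> fixed K 0 \<Longrightarrow> fixed (K + 3 + m * g) 0"
proof -
  obtain t0 where "fixed (1 + 0 - m * 0 * t0) (t0 + 0)" using fixed_next [OF fixed_0] .
  then have p1: "fixed 1 t0" by simp
  obtain t1 where "fixed (1 + 1 - m * 1 * t1) (t1 + t0)" using fixed_next [OF p1] .
  then have p2: "fixed (2 - m * t1) (t1 + t0)" by simp
  obtain t2 where "fixed (1 + (2 - m * t1) - m * (2 - m * t1) * t2) (t2 + (t1 + t0))"
    using fixed_next [OF p2] .
  then have p3: "fixed (3 + m * (- t1 - 2 * t2)) (t2 + (t1 + t0))"
    by (rule fixed_cong) (use dvd_msq [of "t1 * t2"] in \<open>simp_all add: algebra_simps\<close>)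
  obtain u where "fixed (3 + m * u + 0) 0" using fixed_central [OF fixed_0, of 3] by auto
  then have "fixed (3 + m * u) 0" by simp
  from fixed_unique [OF p3 this] have t: "3 dvd t2 + (t1 + t0)" by simp
  let ?g = "- t1 - 2 * t2"
  from p3 t have p3': "fixed (3 + m * ?g) 0" by (elim fixed_cong) simp_all
  show thesis
  proof (rule that)
    fix K assume K: "3 dvd K" and z: "fixed K 0"
    \<comment> \<open>\<open>a^K\<close> is central, so the commutator term of each product with it
      vanishes.\<close>
    have mK: "3 * m dvd m * K * v" for v
    proof -
      have "3 * m dvd K * m" using K by (intro mult_dvd_mono) simp_all
      then show ?thesis by (simp add: mult.commute)
    qed
    \<comment> \<open>In each of the next three cosets one fixed point comes from \<open>a B\<close>
      and another from \<open>a^K C\<close>; uniqueness identifies them and fixes the coordinate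
      \<open>v\<close>.\<close>
    obtain v where v: "fixed (1 + K - m * K * v) (v + 0)" using fixed_next [OF z] .
    obtain u where u: "fixed (K + m * u + 1) t0" using fixed_central [OF p1 K] .
    from v have v': "fixed (K + 1 + m * 0) v"
      by (elim fixed_cong) (use mK [of v] in \<open>simp_all add: algebra_simps\<close>)
    from u have "fixed (K + 1 + m * u) t0" by (simp add: algebra_simps)
    from fixed_unique [OF v' this] have "3 dvd v - t0" by simp
    with v' have q1: "fixed (1 + K) t0" by (elim fixed_cong) simp_all
    obtain v where v: "fixed (1 + (1 + K) - m * (1 + K) * v) (v + t0)" using fixed_next [OF q1] .
    obtain u where u: "fixed (K + m * u + (2 - m * t1)) (t1 + t0)" using fixed_central [OF p2 K] .
    from v have v': "fixed (K + 2 + m * (- v)) (v + t0)"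
      by (elim fixed_cong) (use mK [of v] in \<open>simp_all add: algebra_simps\<close>)
    from u have "fixed (K + 2 + m * (u - t1)) (t1 + t0)" by (simp add: algebra_simps)
    from fixed_unique [OF v' this] have v1: "3 dvd v - t1" by simp
    from v' have q2: "fixed (2 + K - m * t1) (t1 + t0)"
    proof (rule fixed_cong)
      have "K + 2 + m * (- v) - (2 + K - m * t1) = - (m * (v - t1))" by (simp add: algebra_simps)
      then show "3 * m dvd K + 2 + m * (- v) - (2 + K - m * t1)"
        using v1 m_pos by (simp add: mult.commute [of 3 m])
      show "3 dvd v + t0 - (t1 + t0)" using v1 by simp
    qed
    obtain v where v: "fixed (1 + (2 + K - m * t1) - m * (2 + K - m * t1) * v) (v + (t1 + t0))"
      using fixed_next [OF q2] .
    obtain u where u: "fixed (K + m * u + (3 + m * ?g)) 0" using fixed_central [OF p3' K] .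
    from v have v': "fixed (K + 3 + m * (- t1 - 2 * v)) (v + (t1 + t0))"
    proof (rule fixed_cong)
      have "1 + (2 + K - m * t1) - m * (2 + K - m * t1) * v - (K + 3 + m * (- t1 - 2 * v))
        = m * m * (t1 * v) - m * K * v" by (simp add: algebra_simps)
      then show "3 * m dvd 1 + (2 + K - m * t1) - m * (2 + K - m * t1) * v - (K + 3 + m * (- t1 - 2 * v))"
        using dvd_diff [OF dvd_msq mK] by simp
    qed simp
    from u have "fixed (K + 3 + m * (u + ?g)) 0" by (simp add: algebra_simps)
    from fixed_unique [OF v' this] have v2: "3 dvd v + (t1 + t0)" by simp
    from v' show "fixed (K + 3 + m * ?g) 0"
    proof (rule fixed_cong)
      have "K + 3 + m * (- t1 - 2 * v) - (K + 3 + m * ?g) = m * (2 * t2 - 2 * v)"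
        by (simp add: algebra_simps)
      moreover have "3 dvd 2 * t2 - 2 * v" using t v2 by presburger
      ultimately show "3 * m dvd K + 3 + m * (- t1 - 2 * v) - (K + 3 + m * ?g)"
        using m_pos by (simp add: mult.commute [of 3 m])
    qed (use v2 in simp)
  qed
qed

lemma no_two_power_map: "False"
proof -
  obtain g where step: "\<And>K. 3 dvd K \<Longrightarrow> fixed K 0 \<Longrightarrow> fixed (K + 3 + m * g) 0"
    using fixed_step by blast
  have all: "fixed (int i * (3 + m * g)) 0" for i
  proof (induction i)
    case 0
    show ?case by (simp add: fixed_0)
  next
    case (Suc i)
    have "3 dvd int i * (3 + m * g)"
      using three_dvd_m by (intro dvd_mult dvd_add dvd_mult2) simp_all
    from step [OF this Suc.IH] show ?case by (simp add: algebra_simps)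
  qed
  \<comment> \<open>\<open>p\<^sub>3\<close> to the power \<open>m / 3\<close> is \<open>a\<^sup>m = c\<close>, because \<open>m / 3\<close> is still divisible by 3.\<close>
  obtain q where q: "m = 9 * q" using nine ..
  then have "0 < q" using m_pos by simp
  have "int (nat (3 * q)) * (3 + m * g) - m = 3 * m * (q * g)"
    using q \<open>0 < q\<close> by (simp add: algebra_simps)
  then have "3 * m dvd int (nat (3 * q)) * (3 + m * g) - m" by simp
  with all have "fixed m 0" by (rule fixed_cong) simp
  with moved show False by (simp add: fixed_def)
qed

end

text \<open>The ring does not separate \<open>c\<close> from its inverse, so schurity gives a colour
  preserving \<open>\<gamma>\<close> that swaps them. An odd power of \<open>\<gamma>\<close> still
  moves \<open>c\<close> and has 2-power order.\<close>

lemma not_Schur_general: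
  assumes nine: "9 dvd m"
  shows "\<not> Schur_group G"
proof
  assume "Schur_group G"
  then have sch: "schurian G class_ring"
    using is_S_ring_class_ring [OF nine] by (simp add: Schur_group_def)
  have swap: "f (E m 0) = f (E (- m) 0)" if "f \<in> class_ring" for f :: "'a \<Rightarrow> int"
  proof (rule eq_on_class_moves [OF class_fun_class_ring [OF that]])
    have "centred m 0" by (simp add: centred_def)
    moreover have "(E m 0, E (- m) 0) = (E (0 + m * 1) 0, E (0 - m * 1) (- 0))" by simp
    ultimately show "(E m 0, E (- m) 0) \<in> class_moves" unfolding class_moves_def by blast
  qed
  obtain \<gamma> where \<gamma>: "col_preserving G class_ring \<gamma>" "\<gamma> (E m 0) = E (- m) 0"
    by (rule schurian_col_preserving [OF finite_carrier sch _ _ swap]) simp_all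
  have bij: "bij_betw \<gamma> (carrier G) (carrier G)" using \<gamma> by (simp add: col_preserving_def)
  have ne: "E (- m) 0 \<noteq> E m 0"
  proof
    assume "E (- m) 0 = E m 0"
    then have "3 * m dvd m * (- 2)" by (simp add: E_eq_iff)
    then show False using three_m_dvd [of "- 2"] by simp
  qed
  have swapped: "\<gamma> (E (- m) 0) = E m 0"
  proof -
    let ?X = "{E (m * 1) 0, E (- m * 1) (- 0)}"
    have "\<gamma> (E (- m) 0) \<otimes> inv (\<gamma> (E 0 0)) \<in> ?X"
      by (simp only: col_preservingD [OF \<gamma>(1) ul_inverse_pair [OF nine] E_closed E_closed])
        (simp add: E_0_0)
    moreover have "\<gamma> (E 0 0) = \<one>" using \<gamma>(1) by (simp add: col_preserving_def E_0_0)
    ultimately have "\<gamma> (E (- m) 0) \<in> {E m 0, E (- m) 0}"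
      using col_preserving_closed [OF \<gamma>(1) E_closed] by simp
    moreover have "\<gamma> (E (- m) 0) \<noteq> \<gamma> (E m 0)"
      using ne bij_betw_imp_inj_on [OF bij] by (auto dest: inj_onD)
    ultimately show ?thesis using \<gamma>(2) by auto
  qed
  obtain r s where r: "odd r" and pow: "\<And>x. x \<in> carrier G \<Longrightarrow> ((\<gamma> ^^ r) ^^ (2 ^ s)) x = x"
    using bij_betw_two_power_part [OF finite_carrier bij] by blast
  obtain q where q: "r = Suc (2 * q)" using r by (metis oddE Suc_eq_plus1)
  have "(\<gamma> ^^ (2 * q)) (E m 0) = E m 0" for q
    by (induction q) (simp_all add: \<gamma>(2) swapped)
  then have "(\<gamma> ^^ r) (E m 0) \<noteq> E m 0" by (simp add: q \<gamma>(2) ne)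
  with no_two_power_map [OF nine col_preserving_funpow [OF \<gamma>(1)] pow] show False by blast
qed

end

theorem theorem1:
  fixes G :: "('a, 'b) monoid_scheme" and n :: nat and a b :: 'a
  assumes "n \<ge> 3"
    and "group G"
    and "a \<in> carrier G" and "b \<in> carrier G"
    and "generate G {a, b} = carrier G"
    and "a [^]\<^bsub>G\<^esub> ((3::nat) ^ (n - 1)) = \<one>\<^bsub>G\<^esub>"
    and "b [^]\<^bsub>G\<^esub> (3::nat) = \<one>\<^bsub>G\<^esub>"
    and "inv\<^bsub>G\<^esub> b \<otimes>\<^bsub>G\<^esub> a \<otimes>\<^bsub>G\<^esub> b = a [^]\<^bsub>G\<^esub> ((3::nat) ^ (n - 2) + 1)"
    and "card (carrier G) = 3 ^ n"
  shows "\<not> Schur_group G"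
proof -
  define m :: int where "m = 3 ^ (n - 2)"
  have n: "n - 1 = Suc (n - 2)" "n = Suc (Suc (n - 2))" using assms(1) by simp_all
  have m: "3 * m = int (3 ^ (n - 1))" "m + 1 = int (3 ^ (n - 2) + 1)" "9 * m = int (3 ^ n)"
    by (subst n(1) n(2), simp add: m_def)+
  interpret group G by (rule assms(2))
  have "3 dvd m" using assms(1) by (simp add: m_def dvd_power)
  then have M: "modular_3_group G a b m"
    using assms(3-9) group_axioms
    by (intro modular_3_group.intro modular_3_group_axioms.intro)
      (simp_all only: m int_pow_int nat_int, simp_all add: m_def int_pow_int [of G b 3, simplified])
  show ?thesis
  \<comment> \<open>Here \<open>n = 3\<close> means \<open>m = 3\<close>, and every larger
    \<open>n\<close> gives \<open>9 dvd m\<close>.\<close>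
  proof (cases "n = 3")
    case True
    then show ?thesis by (intro modular_3_group.not_Schur_27 [OF M]) (simp add: m_def)
  next
    case False
    then have "(3 :: int) ^ 2 dvd m" unfolding m_def using assms(1) by (intro le_imp_power_dvd) simp
    then show ?thesis by (intro modular_3_group.not_Schur_general [OF M]) simp
  qed
qed

end
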